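(* Let $n \ge 2$ and let $\Omega \subset \mathbb{R}^n$ be an unbounded domain. Let $r_* > 0$ be such that $S_r \cap \Omega \neq \emptyset$ for all $r > r_*$, where $S_r$ is the sphere of radius $r$ centered at the origin. Let $f : \Omega \times [0,\infty) \to \mathbb{R}$ be a function with $f(x,t) > 0$ for all $x \in \Omega$ and all $t > 0$. Suppose there exist real numbers $\sigma > 1$, $\theta > 1$ and non-negative measurable functions $q$ (defined on $(r_*,\infty)$) and $g$ (defined on $(0,\infty)$) with $\inf_K g > 0$ for every compact $K \subset (0,\infty)$, such that $$\inf_{x \in \Omega_{r,\sigma},\ \zeta \in (t/\theta,\, t\theta)} f(x, |x|\zeta) \ge q(r)\, g(t)$$ for all $t > 0$ and $r > r_*$, where $\Omega_{r,\sigma} = \{x \in \Omega : r/\sigma < |x| < r\sigma\}$. Suppose moreover that $$\int_1^\infty (g(t)\,t)^{-1/4}\,dt < \infty \quad\text{and}\quad \int_{r_*}^\infty q(r)\,dr = \infty.$$ Then every non-negative (viscosity) solution $u$ of the problem $$\Delta_\infty u \ge f(x,u) \ \text{in } \Omega, \qquad u|_{\partial\Omega} = 0$$ is identically zero.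
   Context: The $\infty$-Laplacian is $\Delta_\infty u = \sum_{i,j=1}^n \frac{\partial^2 u}{\partial x_i \partial x_j}\frac{\partial u}{\partial x_i}\frac{\partial u}{\partial x_j}$. For $u:\Omega \to \mathbb{R}$ and $x \in \Omega$, the second-order superjet $J^{2,+}_\Omega u(x)$ is the set of pairs $(v,A)$ with $v \in \mathbb{R}^n$ and $A$ a symmetric $n\times n$ matrix such that $u(y) - u(x) \le \langle v, y-x\rangle + \frac12 \langle A(y-x), y-x\rangle + o(|y-x|^2)$ for all $y$ in some neighborhood of $x$. A function $u \ge 0$ on $\overline{\Omega}$ is a non-negative solution of the problem if $u$ is upper semicontinuous on $\overline{\Omega}$ (i.e. $\limsup_{y\to x} u(y) \le u(x)$ for every $x \in \overline\Omega$), $u = 0$ on $\partial\Omega$, and for every $x \in \Omega$ with $J^{2,+}_\Omega u(x) \ne \emptyset$ one has $\langle Av, v\rangle \ge f(x,u(x))$ for all $(v,A) \in J^{2,+}_\Omega u(x)$. If $\Omega = \mathbb{R}^n$ (so $\partial\Omega = \emptyset$), the boundary condition is void. *)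

theory Defs
  imports "HOL-Analysis.Analysis"
begin

definition superjet2 ::
  "(real^('n::finite)) set \<Rightarrow> (real^'n \<Rightarrow> real) \<Rightarrow> real^'n
     \<Rightarrow> ((real^'n) \<times> (real^'n^'n)) set" where
  "superjet2 \<Omega> u x = {(v, A). transpose A = A \<and>
     (\<forall>\<epsilon>>0. \<exists>\<delta>>0. \<forall>y\<in>\<Omega>. dist y x < \<delta> \<longrightarrow>
        u y - u x \<le> v \<bullet> (y - x) + (1/2) * ((A *v (y - x)) \<bullet> (y - x))
                     + \<epsilon> * (norm (y - x))^2)}"

definition usc_on :: "('a::metric_space) set \<Rightarrow> ('a \<Rightarrow> real) \<Rightarrow> bool" where
  "usc_on S u = (\<forall>x\<in>S. \<forall>\<epsilon>>0. \<exists>\<delta>>0. \<forall>y\<in>S. dist y x < \<delta> \<longrightarrow> u y < u x + \<epsilon>)"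

definition nonneg_solution ::
  "(real^'n) set \<Rightarrow> (real^'n \<Rightarrow> real \<Rightarrow> real) \<Rightarrow> (real^'n \<Rightarrow> real) \<Rightarrow> bool" where
  "nonneg_solution \<Omega> f u \<longleftrightarrow>
     (\<forall>x\<in>closure \<Omega>. u x \<ge> 0) \<and>
     usc_on (closure \<Omega>) u \<and>
     (\<forall>x\<in>frontier \<Omega>. u x = 0) \<and>
     (\<forall>x\<in>\<Omega>. \<forall>(v, A)\<in>superjet2 \<Omega> u x. (A *v v) \<bullet> v \<ge> f x (u x))"

end

theory Submission
  imports Defs
begin

text \<open>
  Suppose \<open>u\<close> is positive somewhere and let \<open>N r\<close> be the maximum of \<open>u\<close> over the part of the closed
  domain inside the ball of radius \<open>r\<close>. Testing with radial functions shows that for large \<open>r\<close> the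
  maximum sits on the sphere, and that \<open>N\<close> is strictly increasing, convex and a viscosity
  subsolution of the one-dimensional problem \<open>N'\<^sup>2 N'' \<ge> f\<close>. Testing with solutions of
  \<open>\<psi>'\<^sup>2 \<psi>'' = c\<close> turns this into the growth of \<open>z\<^sup>3\<close> for a subgradient \<open>z\<close> of \<open>N\<close>, so no second
  derivative of \<open>N\<close> is needed.

  Cut \<open>(r\<^sub>0, \<infinity>)\<close> into blocks with endpoints \<open>R k = r\<^sub>0 \<sigma>\<^sup>k\<close>, let \<open>Q k\<close> be the supremum of \<open>q\<close> on the
  \<open>k\<close>-th block, and put \<open>w r = N r / r\<close>. If \<open>w\<close> is bounded, then \<open>Q k R k\<close> is controlled by the
  increment of the bounded quantity \<open>z\<^sup>3\<close>. Otherwise \<open>w\<close> eventually increases to infinity;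
  let \<open>e j\<close> be the integral of \<open>(g t t)\<^sup>-\<^sup>1\<^sup>/\<^sup>4\<close> over \<open>[\<kappa>\<^sup>j, \<kappa>\<^sup>j\<^sup>+\<^sup>1)\<close>. A block on which \<open>w\<close> changes
  level satisfies a Keller-Osserman estimate bounding \<open>(Q k R k)\<^sup>1\<^sup>/\<^sup>4\<close> by the sum of the \<open>e j\<close> over
  the levels it meets, and each level is met by at most two such blocks. The blocks staying in
  level \<open>j\<close> contribute together at most a multiple of \<open>(e j)\<^sup>4\<close>. In all cases the
  sum of \<open>Q k R k\<close> converges, so \<open>q\<close> would be integrable.
\<close>

section \<open>Radial test functions\<close>

text \<open>Otherwise each value \<open>u x\<close> is exceeded at some \<open>b x\<close>, and
  \<open>u\<close> stays below \<open>u (b x)\<close> on a ball around \<open>x\<close>. Among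
  finitely many covering balls take the centre with the largest \<open>u (b x)\<close>; its
  \<open>b x\<close> lies in one of the balls, a contradiction.\<close>

lemma usc_on_attains_sup:
  fixes u :: "'a::metric_space \<Rightarrow> real"
  assumes "compact K" "K \<noteq> {}" "usc_on K u"
  obtains x where "x \<in> K" "\<forall>y\<in>K. u y \<le> u x"
proof (rule ccontr)
  assume "\<not> thesis"
  with that have "\<forall>x\<in>K. \<exists>y\<in>K. u x < u y"
    by (meson not_le)
  then obtain b where b: "\<And>x. x \<in> K \<Longrightarrow> b x \<in> K \<and> u x < u (b x)"
    by metis
  have "\<exists>d>0. \<forall>y\<in>K. dist y x < d \<longrightarrow> u y < u (b x)" if x: "x \<in> K" for x
  proof -
    have "u (b x) - u x > 0" using b[OF x] by simp
    then obtain d where "d > 0" "\<forall>y\<in>K. dist y x < d \<longrightarrow> u y < u x + (u (b x) - u x)"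
      using assms(3) x unfolding usc_on_def by blast
    then show ?thesis by auto
  qed
  then obtain d where d: "\<And>x. x \<in> K \<Longrightarrow> d x > 0 \<and> (\<forall>y\<in>K. dist y x < d x \<longrightarrow> u y < u (b x))"
    by metis
  have "K \<subseteq> (\<Union>x\<in>K. ball x (d x))"
    using d by force
  then obtain F where F: "F \<subseteq> K" "finite F" "K \<subseteq> (\<Union>x\<in>F. ball x (d x))"
    using compactE_image[OF assms(1), of K "\<lambda>x. ball x (d x)"] by auto
  have "F \<noteq> {}" using F(3) assms(2) by auto
  then obtain m where m: "m \<in> F" "\<And>x. x \<in> F \<Longrightarrow> u (b x) \<le> u (b m)"
    using F(2) obtains_MAX[of F "\<lambda>x. u (b x)"] Max_ge
    by (metis (no_types, lifting) finite_imageI image_eqI)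
  have "b m \<in> K" using m(1) F(1) b by blast
  then obtain x where "x \<in> F" "dist (b m) x < d x"
    using F(3) by (auto simp: dist_commute)
  then have "u (b m) < u (b x)" using d F(1) \<open>b m \<in> K\<close> by blast
  with m(2)[OF \<open>x \<in> F\<close>] show False by simp
qed

lemma usc_on_subset: "usc_on S u \<Longrightarrow> T \<subseteq> S \<Longrightarrow> usc_on T u"
  unfolding usc_on_def by (meson subsetD)

lemma usc_on_diff_continuous:
  assumes "usc_on S u" "continuous_on S \<phi>"
  shows "usc_on S (\<lambda>x. u x - \<phi> x)"
  unfolding usc_on_def
proof (intro ballI allI impI)
  fix x and e :: real assume x: "x \<in> S" and e: "e > 0"
  obtain d1 where d1: "d1 > 0" "\<forall>y\<in>S. dist y x < d1 \<longrightarrow> u y < u x + e/2"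
    using assms(1) x e unfolding usc_on_def by (meson half_gt_zero)
  obtain d2 where d2: "d2 > 0" "\<forall>y\<in>S. dist y x < d2 \<longrightarrow> dist (\<phi> y) (\<phi> x) < e/2"
    using assms(2) x e unfolding continuous_on_iff by (meson half_gt_zero)
  show "\<exists>d>0. \<forall>y\<in>S. dist y x < d \<longrightarrow> u y - \<phi> y < u x - \<phi> x + e"
  proof (intro exI[of _ "min d1 d2"] conjI ballI impI)
    fix y assume "y \<in> S" "dist y x < min d1 d2"
    then have "u y < u x + e/2" "\<bar>\<phi> y - \<phi> x\<bar> < e/2"
      using d1 d2 by (auto simp: dist_real_def)
    then show "u y - \<phi> y < u x - \<phi> x + e" by linarith
  qed (use d1 d2 in auto)
qed

section \<open>From radial expansions to superjets\<close>

text \<open>A radial function with derivatives p and X at r = |x| has gradient p e, with e = x / r,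
  and its Hessian \<open>T\<close> is X along e and p / r across it. Evaluated on the gradient only
  the radial eigenvalue counts, which leaves p^2 X.\<close>

lemma radial_superjet2:
  fixes x :: "real^'n" and u :: "real^'n \<Rightarrow> real" and p X :: real
  assumes "x \<noteq> 0"
    and up: "\<And>\<epsilon>. \<epsilon> > 0 \<Longrightarrow> \<exists>\<delta>>0. \<forall>y\<in>\<Omega>. dist y x < \<delta> \<longrightarrow>
      u y - u x \<le> p * (norm y - norm x) + X / 2 * (norm y - norm x)\<^sup>2 + \<epsilon> * (norm y - norm x)\<^sup>2"
  obtains v A where "(v, A) \<in> superjet2 \<Omega> u x" "(A *v v) \<bullet> v = p\<^sup>2 * X"
proof -
  define r where "r = norm x"
  have r: "r > 0" using assms(1) by (simp add: r_def)
  define e where "e = x /\<^sub>R r"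
  have ee: "e \<bullet> e = 1"
    using r by (simp add: e_def r_def power2_norm_eq_inner[symmetric] power2_eq_square[symmetric] field_simps)
  define T where "T = (\<lambda>h. ((X - p / r) * (e \<bullet> h)) *\<^sub>R e + (p / r) *\<^sub>R h)"
  have "linear T"
    by (rule linearI) (simp_all add: T_def inner_simps algebra_simps scaleR_add_right add_divide_distrib)
  define A where "A = matrix T"
  have AT: "A *v h = T h" for h
    using \<open>linear T\<close> by (simp add: A_def matrix_works linear_matrix_vector_mul_eq)
  have "A $ i $ j = (X - p / r) * (e $ j * e $ i) + p / r * (if i = j then 1 else 0)" for i j
    by (simp add: A_def matrix_def T_def inner_axis) (simp add: axis_def)
  then have tr: "transpose A = A"
    by (simp add: vec_eq_iff transpose_def)
  have "(A *v (p *\<^sub>R e)) \<bullet> (p *\<^sub>R e) = p\<^sup>2 * X"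
    using r by (simp add: AT T_def inner_simps ee power2_eq_square field_simps)
  moreover have "(p *\<^sub>R e, A) \<in> superjet2 \<Omega> u x"
    unfolding superjet2_def
  proof (clarsimp simp: tr, goal_cases)
    case (1 \<epsilon>)
    \<comment> \<open>\<open>C\<close> controls the error caused by replacing t^2 by s^2 below;
      \<open>d'\<close> is small enough for this cubic error to stay within half of the allowed
      \<epsilon>.\<close>
    define C where "C = \<bar>X / 2 - p / (2 * r)\<bar>"
    have C: "C \<ge> 0" by (simp add: C_def)
    obtain d where d: "d > 0" "\<forall>y\<in>\<Omega>. dist y x < d \<longrightarrow>
      u y - u x \<le> p * (norm y - norm x) + X / 2 * (norm y - norm x)\<^sup>2 + \<epsilon> / 2 * (norm y - norm x)\<^sup>2"
      using up[of "\<epsilon>/2"] 1 by auto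
    define d' where "d' = \<epsilon> * r / (2 * (C + 1))"
    have d': "d' > 0" using 1 r C by (simp add: d'_def)
    show ?case
    proof (intro exI[of _ "min d d'"] conjI ballI impI)
      fix y assume y: "y \<in> \<Omega>" "dist y x < min d d'"
      define h where "h = y - x"
      define t where "t = norm y - r"
      define s where "s = e \<bullet> h"
      define n where "n = norm h"
      have xr: "x = r *\<^sub>R e" using r by (simp add: e_def)
      have n0: "n \<ge> 0" and nd: "n < d'" using y by (simp_all add: n_def h_def dist_norm)
      have s1: "\<bar>s\<bar> \<le> n"
        using Cauchy_Schwarz_ineq2[of e h] ee by (simp add: s_def n_def norm_eq_sqrt_inner)
      have t1: "\<bar>t\<bar> \<le> n"
        unfolding t_def r_def n_def h_def by (rule norm_triangle_ineq3)
      \<comment> \<open>The resulting identity 2 r (t - s) = n^2 - t^2 gives t - s = O(n^2), hence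
        t^2 - s^2 = O(n^3), and turns p t into p s plus the tangential part of the Hessian.\<close>
      have "(norm y)\<^sup>2 = r\<^sup>2 + 2 * r * s + n\<^sup>2"
      proof -
        have "y = r *\<^sub>R e + h" by (simp add: h_def xr[symmetric])
        then have "y \<bullet> y = r * r + 2 * r * (e \<bullet> h) + h \<bullet> h"
          by (simp add: inner_simps ee inner_commute algebra_simps)
        then show ?thesis
          unfolding n_def s_def power2_norm_eq_inner by (simp add: power2_eq_square)
      qed
      then have ts: "(t - s) * (2 * r) = n\<^sup>2 - t\<^sup>2"
        by (simp add: t_def power2_eq_square algebra_simps)
      have "\<bar>t - s\<bar> * (2 * r) \<le> n\<^sup>2"
      proof -
        have "t\<^sup>2 \<le> n\<^sup>2" using t1 n0 by (simp add: abs_le_square_iff[symmetric])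
        then have "\<bar>(t - s) * (2 * r)\<bar> \<le> n\<^sup>2" unfolding ts by auto
        then show ?thesis using r by (simp add: abs_mult)
      qed
      then have "\<bar>t - s\<bar> \<le> n\<^sup>2 / (2 * r)" using r by (simp add: field_simps)
      moreover have "\<bar>t + s\<bar> \<le> 2 * n" using s1 t1 by linarith
      ultimately have "\<bar>t - s\<bar> * \<bar>t + s\<bar> \<le> n\<^sup>2 / (2 * r) * (2 * n)"
        by (intro mult_mono) (use r in auto)
      then have ts2: "\<bar>t\<^sup>2 - s\<^sup>2\<bar> \<le> n\<^sup>2 * (n / r)"
        using r by (simp add: abs_mult[symmetric] power2_eq_square algebra_simps)
      have "(X / 2 - p / (2 * r)) * (t\<^sup>2 - s\<^sup>2) \<le> C * (n\<^sup>2 * (n / r))"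
      proof -
        have "(X / 2 - p / (2 * r)) * (t\<^sup>2 - s\<^sup>2) \<le> C * \<bar>t\<^sup>2 - s\<^sup>2\<bar>"
          unfolding C_def abs_mult[symmetric] by (rule abs_ge_self)
        also have "\<dots> \<le> C * (n\<^sup>2 * (n / r))" by (intro mult_left_mono ts2 C)
        finally show ?thesis .
      qed
      also have "\<dots> \<le> \<epsilon> / 2 * n\<^sup>2"
      proof -
        have "C * (n / r) \<le> (C + 1) * (d' / r)"
          using nd r C n0 by (intro mult_mono divide_right_mono) auto
        also have "\<dots> = \<epsilon> / 2"
        proof -
          have "C + 1 \<noteq> 0" "r \<noteq> 0" using r C by auto
          then show ?thesis unfolding d'_def by (simp add: divide_simps)
        qed
        finally have "C * (n / r) * n\<^sup>2 \<le> \<epsilon> / 2 * n\<^sup>2" by (rule mult_right_mono) simp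
        then show ?thesis by (simp add: algebra_simps)
      qed
      finally have k1: "(X / 2 - p / (2 * r)) * (t\<^sup>2 - s\<^sup>2) \<le> \<epsilon> / 2 * n\<^sup>2" .
      have k2: "\<epsilon> / 2 * t\<^sup>2 \<le> \<epsilon> / 2 * n\<^sup>2"
        using t1 n0 1 by (intro mult_left_mono) (simp_all add: abs_le_square_iff[symmetric])
      have k3: "p * (t - s) = p * (n\<^sup>2 - t\<^sup>2) / (2 * r)"
        unfolding times_divide_eq_right[symmetric] ts[symmetric] using r by simp
      have "u y - u x \<le> p * t + X / 2 * t\<^sup>2 + \<epsilon> / 2 * t\<^sup>2"
        using d(2) y by (simp add: t_def r_def)
      also have "\<dots> = p * s + ((X - p / r) * s\<^sup>2 + p / r * n\<^sup>2) / 2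
          + (X / 2 - p / (2 * r)) * (t\<^sup>2 - s\<^sup>2) + \<epsilon> / 2 * t\<^sup>2"
      proof -
        have pt: "p * t = p * s + p * (n\<^sup>2 - t\<^sup>2) / (2 * r)" using k3 by (simp add: algebra_simps)
        show ?thesis unfolding pt using r by (simp add: field_simps)
      qed
      also have "\<dots> \<le> p * s + ((X - p / r) * s\<^sup>2 + p / r * n\<^sup>2) / 2 + \<epsilon> * n\<^sup>2"
        using k1 k2 by linarith
      also have "(X - p / r) * s\<^sup>2 + p / r * n\<^sup>2 = (A *v (y - x)) \<bullet> (y - x)"
        unfolding AT T_def h_def[symmetric] s_def n_def power2_norm_eq_inner
        by (simp add: inner_simps power2_eq_square algebra_simps)
      finally show "u y - u x \<le> p * (e \<bullet> (y - x)) + (A *v (y - x)) \<bullet> (y - x) / 2 + \<epsilon> * (norm (y - x))\<^sup>2"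
        by (simp add: s_def n_def h_def)
    qed (use d d' in auto)
  qed
  ultimately show ?thesis using that by blast
qed

text \<open>The remainder \<open>D\<close> has derivative o(|y - r|), so the mean value inequality
  on the segment makes its increment o((s - r)^2). A derivative of \<open>\<psi>'\<close> at the
  single point \<open>r\<close> is enough.\<close>

lemma second_order_expansion:
  fixes \<psi> \<psi>' :: "real \<Rightarrow> real"
  assumes "\<eta> > 0" and d1: "\<And>s. \<bar>s - r\<bar> < \<eta> \<Longrightarrow> (\<psi> has_real_derivative \<psi>' s) (at s)"
    and d2: "(\<psi>' has_real_derivative X) (at r)" and "\<epsilon> > 0"
  obtains \<delta> where "\<delta> > 0"
    "\<And>s. \<bar>s - r\<bar> < \<delta> \<Longrightarrow> \<psi> s - \<psi> r \<le> \<psi>' r * (s - r) + X / 2 * (s - r)\<^sup>2 + \<epsilon> * (s - r)\<^sup>2"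
proof -
  obtain d where d: "d > 0"
    "\<And>s. norm (s - r) < d \<Longrightarrow> norm (\<psi>' s - \<psi>' r - X * (s - r)) \<le> \<epsilon> * norm (s - r)"
    using d2 \<open>\<epsilon> > 0\<close> unfolding has_field_derivative_def has_derivative_at_alt by metis
  define \<delta> where "\<delta> = min d \<eta>"
  show ?thesis
  proof (rule that[of \<delta>])
    show "\<delta> > 0" using d assms by (simp add: \<delta>_def)
    fix s assume s: "\<bar>s - r\<bar> < \<delta>"
    define D where "D = (\<lambda>s. \<psi> s - \<psi>' r * (s - r) - X / 2 * (s - r)\<^sup>2)"
    have der: "(D has_derivative (*) (\<psi>' y - \<psi>' r - X * (y - r))) (at y within closed_segment r s)"
      if y: "y \<in> closed_segment r s" for y
    proof -
      have "\<bar>y - r\<bar> < \<eta>"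
        using y s segment_bound1[OF y] by (auto simp: \<delta>_def)
      from d1[OF this] have "(D has_real_derivative (\<psi>' y - \<psi>' r - X * (y - r))) (at y)"
        unfolding D_def by (auto intro!: derivative_eq_intros simp: field_simps)
      then show ?thesis
        by (metis has_field_derivative_def has_derivative_at_withinI)
    qed
    have "norm (D s - D r) \<le> \<epsilon> * \<bar>s - r\<bar> * norm (s - r)"
    proof (rule differentiable_bound[OF _ der])
      fix y assume y: "y \<in> closed_segment r s"
      have yr: "\<bar>y - r\<bar> \<le> \<bar>s - r\<bar>" using segment_bound1[OF y] by simp
      then have "\<bar>\<psi>' y - \<psi>' r - X * (y - r)\<bar> \<le> \<epsilon> * \<bar>y - r\<bar>" using d(2)[of y] s by (simp add: \<delta>_def)
      also have "\<dots> \<le> \<epsilon> * \<bar>s - r\<bar>" using yr \<open>\<epsilon> > 0\<close> by simp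
      finally show "onorm ((*) (\<psi>' y - \<psi>' r - X * (y - r))) \<le> \<epsilon> * \<bar>s - r\<bar>"
        by (intro onorm_le) (simp add: abs_mult mult_right_mono)
    qed auto
    then have "D s - D r \<le> \<epsilon> * (s - r)\<^sup>2"
      by (simp add: power2_eq_square abs_mult_self_eq mult.assoc)
    then show "\<psi> s - \<psi> r \<le> \<psi>' r * (s - r) + X / 2 * (s - r)\<^sup>2 + \<epsilon> * (s - r)\<^sup>2"
      by (simp add: D_def)
  qed
qed

lemma nonneg_solution_radial_test:
  fixes \<Omega> :: "(real^'n) set" and \<psi> \<psi>' :: "real \<Rightarrow> real"
  assumes sol: "nonneg_solution \<Omega> f u" and x: "x \<in> \<Omega>" "x \<noteq> 0" and "\<eta> > 0"
    and d1: "\<And>s. \<bar>s - norm x\<bar> < \<eta> \<Longrightarrow> (\<psi> has_real_derivative \<psi>' s) (at s)"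
    and d2: "(\<psi>' has_real_derivative X) (at (norm x))"
    and touch: "\<And>y. y \<in> \<Omega> \<Longrightarrow> dist y x < \<eta> \<Longrightarrow> u y - u x \<le> \<psi> (norm y) - \<psi> (norm x)"
  shows "f x (u x) \<le> (\<psi>' (norm x))\<^sup>2 * X"
proof -
  have "\<exists>\<delta>>0. \<forall>y\<in>\<Omega>. dist y x < \<delta> \<longrightarrow> u y - u x \<le> \<psi>' (norm x) * (norm y - norm x)
      + X / 2 * (norm y - norm x)\<^sup>2 + \<epsilon> * (norm y - norm x)\<^sup>2" if "\<epsilon> > 0" for \<epsilon>
  proof -
    obtain d where d: "d > 0" "\<And>s. \<bar>s - norm x\<bar> < d \<Longrightarrow>
        \<psi> s - \<psi> (norm x) \<le> \<psi>' (norm x) * (s - norm x) + X / 2 * (s - norm x)\<^sup>2 + \<epsilon> * (s - norm x)\<^sup>2"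
      using second_order_expansion[OF \<open>\<eta> > 0\<close> d1 d2 \<open>\<epsilon> > 0\<close>] by blast
    show ?thesis
    proof (intro exI[of _ "min d \<eta>"] conjI ballI impI)
      fix y assume y: "y \<in> \<Omega>" "dist y x < min d \<eta>"
      have "\<bar>norm y - norm x\<bar> < d"
        using y norm_triangle_ineq3[of y x] by (simp add: dist_norm)
      from d(2)[OF this] touch[of y] y
      show "u y - u x \<le> \<psi>' (norm x) * (norm y - norm x)
        + X / 2 * (norm y - norm x)\<^sup>2 + \<epsilon> * (norm y - norm x)\<^sup>2" by simp
    qed (use d \<open>\<eta> > 0\<close> in auto)
  qed
  then obtain v A where "(v, A) \<in> superjet2 \<Omega> u x" "(A *v v) \<bullet> v = (\<psi>' (norm x))\<^sup>2 * X"
    using radial_superjet2[OF x(2)] by blast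
  then show ?thesis
    using sol x(1) unfolding nonneg_solution_def by fastforce
qed

text \<open>The zero jet is tested directly because radial tests exclude the origin.\<close>

lemma nonneg_solution_no_local_max:
  fixes \<Omega> :: "(real^'n) set"
  assumes sol: "nonneg_solution \<Omega> f u" and x: "x \<in> \<Omega>" and "\<eta> > 0"
    and touch: "\<And>y. y \<in> \<Omega> \<Longrightarrow> dist y x < \<eta> \<Longrightarrow> u y \<le> u x"
  shows "f x (u x) \<le> 0"
proof -
  have "(0, 0) \<in> superjet2 \<Omega> u x"
    unfolding superjet2_def
  proof (clarsimp, intro conjI allI impI)
    show "transpose 0 = (0 :: real^'n^'n)" by (simp add: vec_eq_iff transpose_def)
    fix \<epsilon> :: real assume "\<epsilon> > 0"
    then show "\<exists>\<delta>>0. \<forall>y\<in>\<Omega>. dist y x < \<delta> \<longrightarrow> u y - u x \<le> \<epsilon> * (norm (y - x))\<^sup>2"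
      using touch \<open>\<eta> > 0\<close>
      by (intro exI[of _ \<eta>]) (smt (verit) mult_nonneg_nonneg zero_le_power2)
  qed
  then show ?thesis
    using sol x(1) unfolding nonneg_solution_def by fastforce
qed

section \<open>The spherical maximum of a positive solution\<close>

locale positive_solution =
  fixes \<Omega> :: "(real^'n) set" and f :: "real^'n \<Rightarrow> real \<Rightarrow> real"
    and u :: "real^'n \<Rightarrow> real" and x\<^sub>1 :: "real^'n"
  assumes open_dom: "open \<Omega>"
    and f_pos: "\<And>x t. x \<in> \<Omega> \<Longrightarrow> t > 0 \<Longrightarrow> f x t > 0"
    and sol: "nonneg_solution \<Omega> f u"
    and x1: "x\<^sub>1 \<in> \<Omega>" "u x\<^sub>1 > 0"
begin

section \<open>The maximum over balls\<close>

definition N :: "real \<Rightarrow> real" where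
  "N r = Sup (u ` (closure \<Omega> \<inter> cball 0 r))"

lemma usc: "usc_on (closure \<Omega>) u"
  using sol by (simp add: nonneg_solution_def)

lemma in_dom: "x \<in> closure \<Omega> \<Longrightarrow> u x > 0 \<Longrightarrow> x \<in> \<Omega>"
  using sol open_dom by (force simp: nonneg_solution_def frontier_def interior_open)

text \<open>The maximum is positive because the ball contains \<open>x\<^sub>1\<close>, so it is not
  attained on the frontier. Attained inside the open ball it would be a local maximum, where
  \<open>f\<close> would have to be at most 0.\<close>

lemma N_attained:
  assumes "norm x\<^sub>1 \<le> r"
  shows "\<exists>x\<in>\<Omega>. norm x = r \<and> u x = N r"
    and "N r > 0"
    and "\<And>y. y \<in> closure \<Omega> \<Longrightarrow> norm y \<le> r \<Longrightarrow> u y \<le> N r"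
    and "\<And>y. y \<in> closure \<Omega> \<Longrightarrow> norm y < r \<Longrightarrow> u y < N r"
proof -
  let ?K = "closure \<Omega> \<inter> cball 0 r"
  have x1K: "x\<^sub>1 \<in> ?K" using x1 assms closure_subset by auto
  have "compact ?K" by (simp add: closed_Int_compact)
  then obtain x where x: "x \<in> ?K" "\<forall>y\<in>?K. u y \<le> u x"
    using usc_on_attains_sup[of ?K u] usc_on_subset[OF usc] x1K by blast
  have Nx: "N r = u x"
    unfolding N_def using x by (intro cSup_eq_maximum) auto
  have pos: "u x > 0" using x(2) x1K x1(2) by force
  have strict: "u y < N r" if y: "y \<in> closure \<Omega>" "norm y < r" for y
  proof (rule ccontr)
    assume "\<not> u y < N r"
    then have uy: "u y = N r" using x(2) y Nx by (simp add: order_antisym not_less)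
    then have "y \<in> \<Omega>" using in_dom y(1) pos Nx by simp
    have "f y (u y) \<le> 0"
    proof (rule nonneg_solution_no_local_max[OF sol \<open>y \<in> \<Omega>\<close>, of "r - norm y"])
      fix z assume z: "z \<in> \<Omega>" "dist z y < r - norm y"
      then have "norm z \<le> r"
        using norm_triangle_sub[of z y] by (simp add: dist_norm)
      then show "u z \<le> u y" using uy Nx x(2) z(1) closure_subset[of \<Omega>] by auto
    qed (use y in simp)
    with f_pos[OF \<open>y \<in> \<Omega>\<close>, of "u y"] show False using uy Nx pos by simp
  qed
  have "norm x = r" using strict[of x] Nx x(1) by force
  then show "\<exists>x\<in>\<Omega>. norm x = r \<and> u x = N r" using in_dom x(1) pos Nx by auto
  show "N r > 0" using pos Nx by simp
  show "u y \<le> N r" if "y \<in> closure \<Omega>" "norm y \<le> r" for y using that x(2) Nx by auto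
  show "u y < N r" if "y \<in> closure \<Omega>" "norm y < r" for y using strict that .
qed

lemma N_strict_mono:
  assumes "norm x\<^sub>1 \<le> r" "r < s"
  shows "N r < N s"
proof -
  obtain x where "x \<in> \<Omega>" "norm x = r" "u x = N r" using N_attained(1)[OF assms(1)] by auto
  then show ?thesis using N_attained(4)[of s x] assms closure_subset[of \<Omega>] by auto
qed

lemma le_N_norm: "x \<in> \<Omega> \<Longrightarrow> norm x\<^sub>1 \<le> norm x \<Longrightarrow> u x \<le> N (norm x)"
  using N_attained(3)[of "norm x" x] closure_subset[of \<Omega>] by auto

section \<open>Convexity and the slope of the maximum\<close>

text \<open>Were \<open>N\<close> above its chord at \<open>c\<close>, a concave radial function
  agreeing with \<open>N\<close> at \<open>a\<close> and \<open>b\<close> would, up to a constant,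
  touch \<open>u\<close> from above strictly inside the annulus. Its infinity-Laplacian is at most 0
  there, while \<open>f\<close> is positive.\<close>

lemma N_le_chord:
  assumes "norm x\<^sub>1 \<le> a" "a < c" "c < b"
  shows "N c \<le> N a + (N b - N a) / (b - a) * (c - a)"
proof (rule ccontr)
  define m where "m = (N b - N a) / (b - a)"
  assume "\<not> ?thesis"
  then have above: "N c - (N a + m * (c - a)) > 0" by (simp add: m_def)
  \<comment> \<open>With this choice the bend adds exactly half of the gap at
    \<open>c\<close>.\<close>
  define \<epsilon> where "\<epsilon> = (N c - (N a + m * (c - a))) / (2 * (c - a) * (b - c))"
  have eps: "\<epsilon> > 0" using above assms by (simp add: \<epsilon>_def)
  \<comment> \<open>the chord bent into a strictly concave parabola that still lies below \<open>N c\<close> at \<open>c\<close>\<close>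
  define P where "P = (\<lambda>r. N a + m * (r - a) + \<epsilon> * (r - a) * (b - r))"
  have "\<epsilon> * (c - a) * (b - c) = (N c - (N a + m * (c - a))) / 2"
  proof -
    have "c - a \<noteq> 0" "b - c \<noteq> 0" using assms by auto
    then show ?thesis unfolding \<epsilon>_def by (simp only: times_divide_eq_left) (simp add: divide_simps)
  qed
  then have Pc: "P c < N c" using above by (simp add: P_def)
  have Pa: "P a = N a" by (simp add: P_def)
  have Pb: "P b = N b" using assms by (simp add: P_def m_def)
  have Na: "0 < N a" using N_attained(2) assms by auto
  have "0 \<le> m" using N_strict_mono[of a b] assms by (simp add: m_def)
  then have Ppos: "P r > 0" if "a \<le> r" "r \<le> b" for r
    using that eps Na by (auto simp: P_def intro!: add_pos_nonneg mult_nonneg_nonneg)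
  let ?K = "closure \<Omega> \<inter> (cball 0 b - ball 0 a)"
  have "compact ?K" by (intro closed_Int_compact compact_diff) auto
  obtain xc where xc: "xc \<in> \<Omega>" "norm xc = c" "u xc = N c"
    using N_attained(1)[of c] assms by auto
  have xcK: "xc \<in> ?K" using xc assms closure_subset by auto
  have "usc_on ?K (\<lambda>x. u x - P (norm x))"
    by (intro usc_on_diff_continuous usc_on_subset[OF usc]) (auto simp: P_def intro!: continuous_intros)
  then obtain x where x: "x \<in> ?K" "\<forall>y\<in>?K. u y - P (norm y) \<le> u x - P (norm x)"
    using usc_on_attains_sup[of ?K "\<lambda>x. u x - P (norm x)"] \<open>compact ?K\<close> xcK by blast
  have xab: "a \<le> norm x" "norm x \<le> b" using x(1) by auto
  have gt: "u x > P (norm x)" using x(2) xcK xc Pc by force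
  have "norm x \<noteq> a" "norm x \<noteq> b"
    using gt N_attained(3)[of "norm x" x] x(1) assms Pa Pb by auto
  then have ab: "a < norm x" "norm x < b" using xab by auto
  have ux: "u x > 0" using gt Ppos[of "norm x"] xab by simp
  then have xO: "x \<in> \<Omega>" using in_dom x(1) by auto
  have "f x (u x) \<le> (m + \<epsilon> * (b - norm x) - \<epsilon> * (norm x - a))\<^sup>2 * (- 2 * \<epsilon>)"
  proof (rule nonneg_solution_radial_test[OF sol xO, where \<psi> = P
        and \<psi>' = "\<lambda>r. m + \<epsilon> * (b - r) - \<epsilon> * (r - a)" and \<eta> = "min (norm x - a) (b - norm x)"])
    show "x \<noteq> 0" using ab assms norm_ge_zero[of x\<^sub>1] by (intro notI) simp
    show "0 < min (norm x - a) (b - norm x)" using ab by simp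
    show "(P has_real_derivative m + \<epsilon> * (b - s) - \<epsilon> * (s - a)) (at s)" for s
      unfolding P_def by (auto intro!: derivative_eq_intros simp: algebra_simps)
    show "((\<lambda>r. m + \<epsilon> * (b - r) - \<epsilon> * (r - a)) has_real_derivative - 2 * \<epsilon>) (at (norm x))"
      by (auto intro!: derivative_eq_intros simp: algebra_simps)
    fix y assume y: "y \<in> \<Omega>" "dist y x < min (norm x - a) (b - norm x)"
    have "y \<in> ?K"
      using y closure_subset norm_triangle_ineq3[of y x] by (auto simp: dist_norm)
    then show "u y - u x \<le> P (norm y) - P (norm x)" using x(2) by force
  qed
  also have "\<dots> \<le> 0" using eps by (simp add: mult_nonneg_nonpos)
  finally show False using f_pos[OF xO ux] by simp
qed

lemma N_convex: "convex_on {norm x\<^sub>1..} N"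
proof (rule convex_onI)
  fix t x y :: real
  assume t: "0 < t" "t < 1" and xy: "x \<in> {norm x\<^sub>1..}" "y \<in> {norm x\<^sub>1..}"
  have *: "N ((1 - t) * x + t * y) \<le> (1 - t) * N x + t * N y"
    if t: "0 < t" "t < 1" and xy: "norm x\<^sub>1 \<le> x" "x < y" for t x y
  proof -
    have "0 < t * (y - x)" "0 < (1 - t) * (y - x)" using t xy by simp_all
    then have "x < (1 - t) * x + t * y" "(1 - t) * x + t * y < y"
      by (simp_all add: algebra_simps)
    from N_le_chord[OF xy(1) this]
    have "N ((1 - t) * x + t * y) \<le> N x + (N y - N x) / (y - x) * (t * (y - x))"
      by (simp add: algebra_simps)
    also have "(N y - N x) / (y - x) * (t * (y - x)) = t * (N y - N x)"
      using xy by simp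
    finally show ?thesis by (simp add: algebra_simps)
  qed
  show "N ((1 - t) *\<^sub>R x + t *\<^sub>R y) \<le> (1 - t) * N x + t * N y"
  proof (cases x y rule: linorder_cases)
    case less
    then show ?thesis using *[of t x y] t xy by simp
  next
    case equal
    then show ?thesis by (simp add: algebra_simps)
  next
    case greater
    then show ?thesis using *[of "1 - t" y x] t xy by (simp add: algebra_simps)
  qed
qed simp

text \<open>The right derivative of the convex function \<^const>\<open>N\<close>; only its subgradient property is used.\<close>

definition z :: "real \<Rightarrow> real" where
  "z r = Inf ((\<lambda>t. (N r - N t) / (r - t)) ` ({r<..} \<inter> {norm x\<^sub>1..}))"

lemma N_subgradient:
  assumes "norm x\<^sub>1 < r" "norm x\<^sub>1 \<le> s"
  shows "N s \<ge> N r + z r * (s - r)"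
  unfolding z_def using assms by (intro convex_le_Inf_differential N_convex) auto

lemma z_pos:
  assumes "norm x\<^sub>1 < r"
  shows "z r > 0"
proof -
  have "N (norm x\<^sub>1) \<ge> N r + z r * (norm x\<^sub>1 - r)" using N_subgradient assms by auto
  moreover have "N (norm x\<^sub>1) < N r" using N_strict_mono assms by auto
  ultimately have "z r * (r - norm x\<^sub>1) > 0" by (simp add: algebra_simps)
  then show ?thesis using assms by (simp add: zero_less_mult_iff)
qed

lemma z_mono:
  assumes "norm x\<^sub>1 < r" "r \<le> s"
  shows "z r \<le> z s"
proof (cases "r = s")
  case False
  have "N s \<ge> N r + z r * (s - r)" "N r \<ge> N s + z s * (r - s)"
    using N_subgradient assms by auto
  then have "z r * (s - r) \<le> z s * (s - r)" by (simp add: algebra_simps)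
  then show ?thesis using False assms by simp
qed simp

lemma N_continuous: "continuous_on {norm x\<^sub>1<..} N"
  by (rule convex_on_continuous)
    (auto intro: convex_on_subset[OF N_convex])

text \<open>This is the integral of (N'^3)' = 3 N'^2 N'' \<ge> 3 c, obtained by comparison. The
  bound on \<open>f\<close> is asked only at points realizing the spherical maximum, since only
  those get touched.\<close>

lemma z_cube_growth:
  assumes ab: "norm x\<^sub>1 < a" "a \<le> b" and c: "c \<ge> 0"
    and f_ge: "\<And>x. x \<in> \<Omega> \<Longrightarrow> a < norm x \<Longrightarrow> norm x < b \<Longrightarrow> u x = N (norm x) \<Longrightarrow> c \<le> f x (u x)"
  shows "z b ^ 3 \<ge> z a ^ 3 + 3 * c * (b - a)"
proof (rule ccontr)
  assume "\<not> ?thesis"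
  then have less: "z b ^ 3 < z a ^ 3 + 3 * c * (b - a)" by simp
  have za: "0 < z a" and zab: "z a \<le> z b" using z_pos z_mono ab by auto
  have "z a ^ 3 \<le> z b ^ 3" using za zab by (intro power_mono) auto
  with less have "c * (b - a) > 0" by simp
  then have c0: "c > 0" and ab': "a < b" using c ab by (auto simp: zero_less_mult_iff)
  \<comment> \<open>A factor \<open>k\<close> slightly below 1 creates strict inequalities
    everywhere: the initial slope of the comparison function falls below \<open>z a\<close>, its
    final slope still exceeds \<open>z b\<close>, and its right-hand side is below
    \<open>c\<close>.\<close>
  have cont: "((\<lambda>k. k * (z a ^ 3 + 3 * c * (b - a))) \<longlongrightarrow> 1 * (z a ^ 3 + 3 * c * (b - a))) (at_left 1)"
    by (intro tendsto_intros)
  have "\<forall>\<^sub>F k in at_left 1. z b ^ 3 < k * (z a ^ 3 + 3 * c * (b - a)) \<and> 0 < k \<and> k < 1"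
    using order_tendstoD(1)[OF cont, of "z b ^ 3"] less
    by (intro eventually_conj) (auto intro: eventually_at_left_real eventually_at_leftI[of 0])
  then obtain k :: real where k: "z b ^ 3 < k * (z a ^ 3 + 3 * c * (b - a))" "0 < k" "k < 1"
    using eventually_happens by (metis (no_types, lifting) trivial_limit_at_left_real)
  define S where "S = (\<lambda>r. k * (z a ^ 3 + 3 * c * (r - a)))"
  \<comment> \<open>\<open>\<psi>'\<^sup>2 \<psi>'' = k c < c\<close>; the slopes of \<open>\<psi>\<close> at \<open>a\<close> and \<open>b\<close> force an interior maximum of \<open>N - \<psi>\<close>\<close>
  define \<psi> where "\<psi> = (\<lambda>r. S r powr (4/3) / (4 * (k * c)))"
  define \<psi>' where "\<psi>' = (\<lambda>r. S r powr (1/3))"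
  have S0: "S r > 0" if "a \<le> r" for r
    using that za k c by (auto simp: S_def intro!: mult_pos_pos add_pos_nonneg)
  have Sev: "\<exists>\<eta>>0. \<forall>s. \<bar>s - r\<bar> < \<eta> \<longrightarrow> S s > 0" if "a \<le> r" for r
  proof -
    have "isCont S r" unfolding S_def by (intro continuous_intros)
    then have "\<forall>\<^sub>F s in at r. S s > 0" using order_tendstoD(1) S0[OF that] isCont_def by blast
    then show ?thesis using S0[OF that] unfolding eventually_at dist_real_def by (metis UNIV_I)
  qed
  have der: "(\<psi> has_real_derivative \<psi>' r) (at r)" if "S r > 0" for r
    unfolding \<psi>_def \<psi>'_def using that k c0
    by (auto intro!: derivative_eq_intros simp: S_def field_simps powr_diff powr_minus)
  have cube: "\<psi>' r ^ 3 = S r" if "S r > 0" for r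
    using that by (simp add: \<psi>'_def powr_power)
  have der2: "(\<psi>' has_real_derivative k * c / (\<psi>' r)\<^sup>2) (at r)" if "S r > 0" for r
  proof -
    have "(\<psi>' has_real_derivative (1/3) * S r powr (1/3 - 1) * (k * (3 * c))) (at r)"
      unfolding \<psi>'_def using that
      by (auto intro!: derivative_eq_intros simp: S_def)
    moreover have "S r powr (1/3 - 1) = 1 / (\<psi>' r)\<^sup>2"
      using that by (simp add: \<psi>'_def powr_power powr_minus_divide[symmetric])
    ultimately show ?thesis by (simp add: field_simps)
  qed
  have contD: "continuous_on {a..b} (\<lambda>r. N r - \<psi> r)"
  proof (intro continuous_on_diff)
    show "continuous_on {a..b} N" using N_continuous by (rule continuous_on_subset) (use ab in auto)
    show "continuous_on {a..b} \<psi>"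
      by (intro continuous_at_imp_continuous_on ballI) (meson DERIV_isCont S0 atLeastAtMost_iff der)
  qed
  obtain r where r: "r \<in> {a..b}" "\<forall>s\<in>{a..b}. N s - \<psi> s \<le> N r - \<psi> r"
    using continuous_attains_sup[OF _ _ contD] ab by auto
  \<comment> \<open>Near \<open>a\<close> the difference quotients of \<open>\<psi>\<close> are
    below \<open>z a\<close>, while the subgradient makes \<open>N\<close> grow at least at that
    rate, so \<open>N - \<psi>\<close> increases to the right of \<open>a\<close>. The end
    \<open>b\<close> is mirrored.\<close>
  have "r \<noteq> a"
  proof
    assume "r = a"
    have lt: "\<psi>' a < z a"
    proof (rule power_less_imp_less_base[of _ 3])
      show "\<psi>' a ^ 3 < z a ^ 3" using cube[of a] S0[of a] k za by (simp add: S_def)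
    qed (use za in simp)
    have "((\<lambda>s. (\<psi> s - \<psi> a) / (s - a)) \<longlongrightarrow> \<psi>' a) (at a)"
      using der[OF S0] by (simp add: has_field_derivative_iff)
    from order_tendstoD(2)[OF this lt]
    obtain d where d: "d > 0" "\<And>s. s \<noteq> a \<Longrightarrow> \<bar>s - a\<bar> < d \<Longrightarrow> (\<psi> s - \<psi> a) / (s - a) < z a"
      unfolding eventually_at dist_real_def by blast
    define s where "s = min b (a + d/2)"
    have s: "a < s" "s \<le> b" "\<bar>s - a\<bar> < d" using d ab' by (auto simp: s_def)
    have "\<psi> s - \<psi> a < z a * (s - a)" using d(2)[of s] s by (simp add: field_simps)
    moreover have "N s \<ge> N a + z a * (s - a)" using N_subgradient ab s by auto
    ultimately show False using bspec[OF r(2), of s] s \<open>r = a\<close> by simp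
  qed
  moreover have "r \<noteq> b"
  proof
    assume "r = b"
    have lt: "z b < \<psi>' b"
    proof (rule power_less_imp_less_base[of _ 3])
      show "z b ^ 3 < \<psi>' b ^ 3" using cube[of b] S0[of b] k ab by (simp add: S_def)
    qed (simp add: \<psi>'_def)
    have "((\<lambda>s. (\<psi> s - \<psi> b) / (s - b)) \<longlongrightarrow> \<psi>' b) (at b)"
      using der[OF S0] ab by (simp add: has_field_derivative_iff)
    from order_tendstoD(1)[OF this lt]
    obtain d where d: "d > 0" "\<And>s. s \<noteq> b \<Longrightarrow> \<bar>s - b\<bar> < d \<Longrightarrow> (\<psi> s - \<psi> b) / (s - b) > z b"
      unfolding eventually_at dist_real_def by blast
    define s where "s = max a (b - d/2)"
    have s: "a \<le> s" "s < b" "\<bar>s - b\<bar> < d" using d ab' by (auto simp: s_def)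
    have "\<psi> s - \<psi> b < z b * (s - b)" using d(2)[of s] s by (simp add: field_simps)
    moreover have "N s \<ge> N b + z b * (s - b)" using N_subgradient ab s by auto
    ultimately show False using bspec[OF r(2), of s] s \<open>r = b\<close> by simp
  qed
  ultimately have rab: "a < r" "r < b" using r(1) by auto
  obtain x where x: "x \<in> \<Omega>" "norm x = r" "u x = N r" using N_attained(1)[of r] ab rab by auto
  obtain \<eta> where \<eta>: "\<eta> > 0" "\<And>s. \<bar>s - r\<bar> < \<eta> \<Longrightarrow> S s > 0" using Sev[of r] rab by auto
  have "f x (u x) \<le> (\<psi>' (norm x))\<^sup>2 * (k * c / (\<psi>' r)\<^sup>2)"
  proof (rule nonneg_solution_radial_test[OF sol x(1), where \<psi> = \<psi> and \<psi>' = \<psi>'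
        and \<eta> = "min \<eta> (min (r - a) (b - r))"])
    show "x \<noteq> 0" using rab ab x(2) norm_ge_zero[of x\<^sub>1] by (intro notI) simp
    show "0 < min \<eta> (min (r - a) (b - r))" using rab \<eta> by simp
    show "(\<psi> has_real_derivative \<psi>' s) (at s)" if "\<bar>s - norm x\<bar> < min \<eta> (min (r - a) (b - r))" for s
      using that \<eta> x(2) der by simp
    show "(\<psi>' has_real_derivative k * c / (\<psi>' r)\<^sup>2) (at (norm x))"
      using der2[OF S0] rab x(2) by simp
    fix y assume y: "y \<in> \<Omega>" "dist y x < min \<eta> (min (r - a) (b - r))"
    have "norm y \<in> {a..b}"
      using y norm_triangle_ineq3[of y x] x(2) by (auto simp: dist_norm)
    then have "N (norm y) - \<psi> (norm y) \<le> N r - \<psi> r" "u y \<le> N (norm y)"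
      using r(2) le_N_norm[OF y(1)] ab by auto
    then show "u y - u x \<le> \<psi> (norm y) - \<psi> (norm x)" using x by simp
  qed
  also have "\<dots> = k * c"
    using S0[of r] rab x(2) by (simp add: \<psi>'_def)
  also have "\<dots> < c" using k c0 by simp
  finally show False using f_ge[of x] x rab by simp
qed

end

section \<open>One-dimensional growth estimates\<close>

text \<open>The tail sums telescope. Both cases of the growth argument end here, with a potential
  built from truncated or bounded slopes and from level weights.\<close>

lemma summable_by_bounded_potential:
  fixes H \<Phi> :: "nat \<Rightarrow> real"
  assumes "\<And>k. 0 \<le> H k" "\<And>k. K \<le> k \<Longrightarrow> H k \<le> \<Phi> (Suc k) - \<Phi> k" "\<And>k. K \<le> k \<Longrightarrow> \<Phi> k \<le> B"
  shows "summable H"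
proof -
  have "(\<Sum>k<n. H (k + K)) \<le> B - \<Phi> K" for n
  proof -
    have "(\<Sum>k<n. H (k + K)) \<le> (\<Sum>k<n. \<Phi> (Suc k + K) - \<Phi> (k + K))"
      using assms(2) by (intro sum_mono) simp
    also have "\<dots> = \<Phi> (n + K) - \<Phi> K"
      using sum_lessThan_telescope[of "\<lambda>k. \<Phi> (k + K)" n] by simp
    also have "\<dots> \<le> B - \<Phi> K" using assms(3)[of "n + K"] by simp
    finally show ?thesis .
  qed
  then have "summable (\<lambda>k. H (k + K))"
    using assms(1) by (intro summableI_nonneg_bounded[of _ "B - \<Phi> K"]) auto
  then show ?thesis by (simp add: summable_iff_shift)
qed

lemma power_level_exists:
  fixes b x :: real
  assumes "1 < b" "1 \<le> x"
  shows "\<exists>n. b ^ n \<le> x \<and> x < b ^ Suc n"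
proof -
  define n where "n = (LEAST n. x < b ^ n)"
  have ex: "\<exists>n. x < b ^ n" using real_arch_pow assms by auto
  have n: "x < b ^ n" unfolding n_def using ex by (rule LeastI_ex)
  then have "n \<noteq> 0" using assms by (intro notI) simp
  then obtain m where m: "n = Suc m" using not0_implies_Suc by auto
  have "\<not> x < b ^ m" using not_less_Least[of m "\<lambda>n. x < b ^ n"] m n_def by simp
  then show ?thesis using n m by (intro exI[of _ m]) auto
qed

text \<open>What remains once the domain, \<open>f\<close> and \<open>u\<close> are eliminated:
  \<open>Q k\<close> stands for the supremum of \<open>q\<close> on block \<open>k\<close>. In
  \<open>growth\<close> the reference value \<open>t\<close> may vary with \<open>r\<close>: for
  bounded N r / r it is that ratio itself, otherwise one fixed \<open>t\<close> serves a whole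
  interval.\<close>

locale radial_growth =
  fixes N z g :: "real \<Rightarrow> real" and Q :: "nat \<Rightarrow> real" and a r\<^sub>0 \<sigma> \<theta> :: real
  assumes a: "a \<ge> 0" and r0: "r\<^sub>0 > 0" and sigma: "\<sigma> > 1" and theta: "\<theta> > 1"
    and Q: "\<And>k. Q k \<ge> 0" and g_pos: "\<And>t. t > 0 \<Longrightarrow> g t > 0"
    and N_pos: "\<And>r. r > a \<Longrightarrow> N r > 0"
    and z_pos: "\<And>r. r > a \<Longrightarrow> z r > 0"
    and subgradient: "\<And>r s. r > a \<Longrightarrow> s > a \<Longrightarrow> N s \<ge> N r + z r * (s - r)"
    and N_cont: "continuous_on {a<..} N"
    and growth: "\<And>\<rho> \<rho>' k \<gamma>. a < \<rho> \<Longrightarrow> \<rho> \<le> \<rho>' \<Longrightarrow> r\<^sub>0 * \<sigma> ^ k \<le> \<rho> \<Longrightarrow> \<rho>' \<le> r\<^sub>0 * \<sigma> ^ Suc k \<Longrightarrow> \<gamma> \<ge> 0 \<Longrightarrow>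
      (\<And>r. \<rho> < r \<Longrightarrow> r < \<rho>' \<Longrightarrow> \<exists>t>0. t / \<theta> < N r / r \<and> N r / r < t * \<theta> \<and> \<gamma> \<le> g t) \<Longrightarrow>
      z \<rho>' ^ 3 \<ge> z \<rho> ^ 3 + 3 * (Q k * \<gamma>) * (\<rho>' - \<rho>)"
begin

definition R :: "nat \<Rightarrow> real" where "R k = r\<^sub>0 * \<sigma> ^ k"
definition w :: "real \<Rightarrow> real" where "w r = N r / r"
text \<open>Up to the factor \<sigma> - 1, the integral over block \<open>k\<close> of the constant
  \<open>Q k\<close>.\<close>

definition H :: "nat \<Rightarrow> real" where "H k = Q k * R k"

lemma R_pos: "R k > 0" using r0 sigma by (simp add: R_def)
lemma R_Suc: "R (Suc k) = \<sigma> * R k" by (simp add: R_def)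
lemma R_less_Suc: "R k < R (Suc k)" using R_pos[of k] sigma by (simp add: R_Suc)

lemma R_mono: "i \<le> k \<Longrightarrow> R i \<le> R k"
  using lift_Suc_mono_le[of R] R_less_Suc less_imp_le by blast

lemma R_unbounded: "\<exists>k. b < R k"
proof -
  obtain k where "b / r\<^sub>0 < \<sigma> ^ k" using real_arch_pow sigma by blast
  then show ?thesis using r0 by (intro exI[of _ k]) (simp add: R_def field_simps)
qed

lemma H_nonneg: "H k \<ge> 0" using Q R_pos[of k] by (simp add: H_def less_imp_le)

lemma N_eq_w: "r > a \<Longrightarrow> N r = r * w r" using a by (simp add: w_def)

lemma w_pos: "r > a \<Longrightarrow> w r > 0" using a N_pos by (simp add: w_def)

lemma z_mono: assumes "a < r" "r \<le> s" shows "z r \<le> z s"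
proof (cases "r = s")
  case False
  have "N s \<ge> N r + z r * (s - r)" "N r \<ge> N s + z s * (r - s)"
    using subgradient assms by auto
  then have "z r * (s - r) \<le> z s * (s - r)" by (simp add: algebra_simps)
  then show ?thesis using False assms by simp
qed simp

section \<open>Bounded ratio N r / r\<close>

text \<open>The affine minorant of slope \<open>z b\<close> has height \<open>b * w b\<close> at
  \<open>b\<close>, so beyond \<open>b\<close> it stays above the line through the origin of slope
  \<open>min (z b) (w b)\<close>.\<close>

lemma w_lower:
  assumes "a < b"
  obtains \<mu> where "\<mu> > 0" "\<And>r. b \<le> r \<Longrightarrow> \<mu> \<le> w r"
proof (rule that[of "min (z b) (w b)"])
  show "min (z b) (w b) > 0" using z_pos w_pos assms by simp
  fix r assume "b \<le> r"
  have "min (z b) (w b) * r = b * min (z b) (w b) + min (z b) (w b) * (r - b)" by (simp add: algebra_simps)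
  also have "\<dots> \<le> b * w b + z b * (r - b)"
    using \<open>b \<le> r\<close> assms a by (intro add_mono mult_left_mono mult_right_mono) auto
  also have "\<dots> \<le> N r" using subgradient[of b r] N_eq_w assms \<open>b \<le> r\<close> by simp
  finally show "min (z b) (w b) \<le> w r" using \<open>b \<le> r\<close> assms a by (simp add: w_def pos_le_divide_eq)
qed

text \<open>Here \<open>w\<close> ranges over a compact interval on which \<open>g\<close> is at
  least some \<gamma> > 0, so each block raises z^3 by a fixed multiple of
  \<open>H k\<close>.\<close>

lemma summable_if_bounded:
  assumes b: "b > a" and B: "\<And>r. r \<ge> b \<Longrightarrow> w r \<le> B"
    and g_inf: "\<And>\<alpha> \<beta>. 0 < \<alpha> \<Longrightarrow> \<alpha> \<le> \<beta> \<Longrightarrow> \<exists>\<gamma>>0. \<forall>t\<in>{\<alpha>..\<beta>}. \<gamma> \<le> g t"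
  shows "summable H"
proof -
  obtain K where K': "b < R K" using R_unbounded by blast
  then have K: "a < R K" using b by simp
  have RKb: "b \<le> R k" if "K \<le> k" for k using K' R_mono[OF that] by simp
  then have RK: "a < R k" if "K \<le> k" for k using that b by force
  obtain \<mu> where \<mu>: "\<mu> > 0" "\<And>r. R K \<le> r \<Longrightarrow> \<mu> \<le> w r" using w_lower[OF K] by blast
  have "\<mu> \<le> B" using \<mu>(2)[of "R K"] B[of "R K"] K' by simp
  then obtain \<gamma> where \<gamma>: "\<gamma> > 0" "\<And>t. t \<in> {\<mu>..B} \<Longrightarrow> \<gamma> \<le> g t" using g_inf \<mu> by blast
  define c where "c = 3 * \<gamma> * (\<sigma> - 1)"
  have c: "c > 0" using \<gamma> sigma by (simp add: c_def)
  \<comment> \<open>Doubling the radius costs at least \<open>z r * r\<close>, yet N (2 r) is at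
    most 2 r B.\<close>
  have zB: "z r \<le> 2 * B" if rb: "r \<ge> b" for r
  proof -
    have r: "r > a" using rb b by simp
    have "N (2 * r) \<ge> N r + z r * (2 * r - r)" using subgradient[of r "2 * r"] r a by simp
    then have "z r * r \<le> N (2 * r)" using N_pos[OF r] by simp
    also have "\<dots> \<le> 2 * r * B" using N_eq_w[of "2 * r"] B[of "2 * r"] rb r a by simp
    finally show ?thesis using r a by simp
  qed
  show ?thesis
  proof (rule summable_by_bounded_potential[where \<Phi> = "\<lambda>k. z (R k) ^ 3 / c" and K = K and B = "(2 * B) ^ 3 / c"])
    fix k assume k: "K \<le> k"
    show "z (R k) ^ 3 / c \<le> (2 * B) ^ 3 / c"
      using zB[OF RKb[OF k]] z_pos[OF RK[OF k]] c by (intro divide_right_mono power_mono) auto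
    have "z (R (Suc k)) ^ 3 \<ge> z (R k) ^ 3 + 3 * (Q k * \<gamma>) * (R (Suc k) - R k)"
    proof (rule growth)
      fix r assume r: "R k < r" "r < R (Suc k)"
      then have "R K \<le> r" "r > a" "r \<ge> b" using RK[OF k] R_mono[OF k] RKb[OF k] by auto
      then have "w r > 0" "\<gamma> \<le> g (w r)" using w_pos \<gamma>(2) \<mu>(2) B by auto
      then show "\<exists>t>0. t / \<theta> < N r / r \<and> N r / r < t * \<theta> \<and> \<gamma> \<le> g t"
        using theta by (intro exI[of _ "w r"]) (simp add: w_def[symmetric] field_simps)
    qed (use RK[OF k] R_less_Suc[of k] \<gamma> in \<open>auto simp: R_def\<close>)
    also have "3 * (Q k * \<gamma>) * (R (Suc k) - R k) = c * H k"
      by (simp add: c_def H_def R_Suc algebra_simps)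
    finally show "H k \<le> z (R (Suc k)) ^ 3 / c - z (R k) ^ 3 / c"
      using c by (simp add: field_simps)
  qed (rule H_nonneg)
qed

section \<open>Unbounded ratio N r / r\<close>

text \<open>If \<open>w s\<close> is at least the value of \<open>w\<close> at an earlier radius,
  convexity forces \<open>z s \<ge> w s\<close>, and beyond \<open>s\<close> the graph of
  \<open>N\<close> stays above the ray of slope \<open>w s\<close>. Unboundedness provides such an
  \<open>s\<close> with ratio above 1.\<close>

lemma w_eventually_mono:
  assumes unb: "\<And>b B. b > a \<Longrightarrow> \<exists>r\<ge>b. w r > B"
  obtains b where "b > a" "\<And>r s. b \<le> r \<Longrightarrow> r \<le> s \<Longrightarrow> w r \<le> w s" "\<And>r. b \<le> r \<Longrightarrow> 1 \<le> w r"
proof -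
  define b\<^sub>1 where "b\<^sub>1 = a + 1"
  have step: "w s \<le> w t" if "b\<^sub>1 < s" "s \<le> t" "w b\<^sub>1 \<le> w s" for s t
  proof -
    have s: "s > a" "s > 0" "t > a" "b\<^sub>1 > a" using that a by (auto simp: b\<^sub>1_def)
    have "N b\<^sub>1 \<ge> N s + z s * (b\<^sub>1 - s)" using subgradient[of s b\<^sub>1] s by simp
    moreover have "N b\<^sub>1 \<le> b\<^sub>1 * w s" using N_eq_w[of b\<^sub>1] s that a by (simp add: b\<^sub>1_def)
    ultimately have "w s * (s - b\<^sub>1) \<le> z s * (s - b\<^sub>1)" using N_eq_w[of s] s by (simp add: algebra_simps)
    then have "w s \<le> z s" using that by simp
    then have "w s * (t - s) \<le> z s * (t - s)" using that by (intro mult_right_mono) auto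
    also have "\<dots> \<le> N t - N s" using subgradient[of s t] s by simp
    finally have "w s * t \<le> N t" using N_eq_w[of s] s by (simp add: algebra_simps)
    then show ?thesis using s a by (simp add: w_def pos_le_divide_eq)
  qed
  obtain b where b: "b \<ge> b\<^sub>1 + 1" "w b > max 1 (w b\<^sub>1)"
    using unb[of "b\<^sub>1 + 1" "max 1 (w b\<^sub>1)"] by (auto simp: b\<^sub>1_def)
  have ge: "w b \<le> w r" if "b \<le> r" for r using step[of b r] that b by simp
  show ?thesis
  proof (rule that[of b])
    show "b > a" using b by (simp add: b\<^sub>1_def)
    show "w r \<le> w s" if "b \<le> r" "r \<le> s" for r s
      using step[of r s] ge[of r] that b by simp
    show "1 \<le> w r" if "b \<le> r" for r using ge[OF that] b by simp
  qed
qed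

text \<open>Both \<open>t\<close> and \<open>w r\<close> lie in level \<open>i\<close>, so they
  differ by a factor of at most \<kappa> < \<theta>; one \<open>t\<close> therefore serves the whole
  interval.\<close>

lemma level_interval_bound:
  assumes \<kappa>: "1 < \<kappa>" "\<kappa> < \<theta>" and b: "b > a"
    and w_mono: "\<And>r s. b \<le> r \<Longrightarrow> r \<le> s \<Longrightarrow> w r \<le> w s"
    and t: "\<kappa> ^ i \<le> t" "t < \<kappa> ^ Suc i"
    and \<rho>: "b \<le> \<rho>" "\<rho> \<le> \<rho>'" "R k \<le> \<rho>" "\<rho>' \<le> R (Suc k)"
    and wl: "\<kappa> ^ i \<le> w \<rho>" "w \<rho>' \<le> \<kappa> ^ Suc i"
  shows "z \<rho>' ^ 3 \<ge> z \<rho> ^ 3 + 3 * (Q k * g t) * (\<rho>' - \<rho>)"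
proof (rule growth)
  have ki: "\<kappa> ^ i > 0" using \<kappa> by simp
  then have t0: "t > 0" using t by simp
  then show "0 \<le> g t" using g_pos less_imp_le by blast
  fix r assume r: "\<rho> < r" "r < \<rho>'"
  have wr: "\<kappa> ^ i \<le> w r" "w r \<le> \<kappa> * \<kappa> ^ i"
    using w_mono[of \<rho> r] w_mono[of r \<rho>'] r \<rho> wl by auto
  have "t < \<theta> * \<kappa> ^ i"
    using t(2) mult_strict_right_mono[OF \<kappa>(2) ki] unfolding power_Suc by linarith
  also have "\<dots> \<le> \<theta> * w r" using wr theta by simp
  finally have "t / \<theta> < w r" using theta by (simp add: field_simps)
  moreover have "w r < t * \<theta>"
  proof -
    have "w r \<le> \<kappa> * t" using wr t \<kappa> by (meson mult_left_mono order_trans less_imp_le less_trans zero_less_one)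
    also have "\<dots> < t * \<theta>" using \<kappa> t0 by simp
    finally show ?thesis .
  qed
  ultimately show "\<exists>t'>0. t' / \<theta> < N r / r \<and> N r / r < t' * \<theta> \<and> g t \<le> g t'"
    using t0 by (intro exI[of _ t]) (simp add: w_def)
qed (use \<rho> b in \<open>auto simp: R_def\<close>)

text \<open>The slope is taken at the midpoint because the subgradient inequality needs room to the
  right before the size of \<open>N\<close> at the end can limit it.\<close>

lemma z_mid_bound:
  assumes "a < \<rho>" "\<rho> \<le> \<rho>'" "\<rho>' \<le> R (Suc k)" "w \<rho>' \<le> \<kappa> ^ Suc i" "0 < \<kappa>"
  shows "z ((\<rho> + \<rho>') / 2) * ((\<rho>' - \<rho>) / 2) \<le> \<kappa> ^ i * (\<sigma> * \<kappa> * R k)"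
proof -
  let ?m = "(\<rho> + \<rho>') / 2"
  have "N \<rho>' \<ge> N ?m + z ?m * (\<rho>' - ?m)" using subgradient assms by simp
  moreover have "\<rho>' - ?m = (\<rho>' - \<rho>) / 2" by (simp add: field_simps)
  ultimately have "z ?m * ((\<rho>' - \<rho>) / 2) \<le> N \<rho>'" using N_pos[of ?m] assms by simp
  also have "\<dots> = \<rho>' * w \<rho>'" using N_eq_w assms by simp
  also have "\<dots> \<le> (\<sigma> * R k) * \<kappa> ^ Suc i"
    using assms a w_pos[of \<rho>'] R_Suc R_pos[of k] sigma by (intro mult_mono) auto
  finally show ?thesis by (simp add: algebra_simps)
qed

text \<open>\<open>key\<close> is the integral condition on \<open>g\<close> localized to one level.
  Blocks changing level are charged to the potential \<open>V\<close>, blocks staying in a level to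
  \<open>\<Phi>\<close>.\<close>

lemma summable_if_unbounded:
  fixes e :: "nat \<Rightarrow> real"
  assumes unb: "\<And>b B. b > a \<Longrightarrow> \<exists>r\<ge>b. w r > B"
    and \<kappa>: "1 < \<kappa>" "\<kappa> < \<theta>" and e: "\<And>j. e j \<ge> 0" "summable e" and C: "C \<ge> 0"
    and key: "\<And>j y m. y \<ge> 0 \<Longrightarrow> m \<ge> 0 \<Longrightarrow>
      (\<And>t. \<kappa> ^ j \<le> t \<Longrightarrow> t < \<kappa> ^ Suc j \<Longrightarrow> y * g t \<le> (\<kappa> ^ j) ^ 3 * m) \<Longrightarrow> y \<le> C * m * e j ^ 4"
  shows "summable H"
proof -
  obtain b where b: "b > a" and w_mono: "\<And>r s. b \<le> r \<Longrightarrow> r \<le> s \<Longrightarrow> w r \<le> w s"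
    and w1: "\<And>r. b \<le> r \<Longrightarrow> 1 \<le> w r"
    using w_eventually_mono[OF unb] by blast
  obtain K where K: "b < R K" using R_unbounded by blast
  have RK: "b \<le> R k" if "K \<le> k" for k using K R_mono[OF that] by simp
  define h where "h = (\<lambda>k. root 4 (H k))"
  have h0: "h k \<ge> 0" and h4: "h k ^ 4 = H k" for k
    using H_nonneg[of k] by (simp_all add: h_def)
  \<comment> \<open>16/3 undoes the factor 3 of \<open>growth\<close> and the 1/16 from the fourth
    power of a half-length.\<close>
  define C1 where "C1 = root 4 (16 / 3 * C * (\<sigma> * \<kappa>) ^ 3)"
  have C1: "C1 \<ge> 0" "C1 ^ 4 = 16 / 3 * C * (\<sigma> * \<kappa>) ^ 3"
    using C sigma \<kappa> by (simp_all add: C1_def)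
  \<comment> \<open>The first half of the interval raises z^3 in proportion to
    \<open>Q k * g t\<close>; over the second half the size of \<open>N\<close> limits
    \<open>z\<close> at the midpoint. Together they feed \<open>key\<close>, and a fourth root
    follows.\<close>
  have level: "(\<rho>' - \<rho>) * h k \<le> C1 * R k * e i"
    if \<rho>: "b \<le> \<rho>" "\<rho> \<le> \<rho>'" "R k \<le> \<rho>" "\<rho>' \<le> R (Suc k)"
      and wl: "\<kappa> ^ i \<le> w \<rho>" "w \<rho>' \<le> \<kappa> ^ Suc i" for \<rho> \<rho>' k i
  proof -
    define d where "d = \<rho>' - \<rho>"
    have d: "d \<ge> 0" using \<rho> by (simp add: d_def)
    define m where "m = (\<rho> + \<rho>') / 2"
    have m: "\<rho> \<le> m" "m \<le> \<rho>'" "m - \<rho> = d / 2" using \<rho> by (auto simp: m_def d_def field_simps)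
    have "3 * Q k * (d / 2) ^ 4 \<le> C * (\<sigma> * \<kappa> * R k) ^ 3 * e i ^ 4"
    proof (rule key)
      show "0 \<le> 3 * Q k * (d / 2) ^ 4" using Q by simp
      show "0 \<le> (\<sigma> * \<kappa> * R k) ^ 3" using sigma \<kappa> R_pos[of k] by simp
      fix t assume t: "\<kappa> ^ i \<le> t" "t < \<kappa> ^ Suc i"
      have "z m ^ 3 \<ge> z \<rho> ^ 3 + 3 * (Q k * g t) * (m - \<rho>)"
        using m \<rho> wl w_mono[of m \<rho>']
        by (intro level_interval_bound[OF \<kappa> b w_mono t]) auto
      then have zm: "3 * (Q k * g t) * (d / 2) \<le> z m ^ 3"
        using m(3) z_pos[of \<rho>] b \<rho> by (smt (verit) zero_less_power)
      have "3 * Q k * (d / 2) ^ 4 * g t = (3 * (Q k * g t) * (d / 2)) * (d / 2) ^ 3"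
        by (simp add: power_numeral_reduce)
      also have "\<dots> \<le> z m ^ 3 * (d / 2) ^ 3"
        using zm d by (intro mult_right_mono) auto
      also have "\<dots> = (z m * (d / 2)) ^ 3" by (simp add: power_mult_distrib[symmetric])
      also have "\<dots> \<le> (\<kappa> ^ i * (\<sigma> * \<kappa> * R k)) ^ 3"
        using z_mid_bound[of \<rho> \<rho>' k \<kappa> i] \<rho> b wl \<kappa> z_pos[of m] m d
        by (intro power_mono) (auto simp: m_def d_def)
      also have "\<dots> = (\<kappa> ^ i) ^ 3 * (\<sigma> * \<kappa> * R k) ^ 3" by (rule power_mult_distrib)
      finally show "3 * Q k * (d / 2) ^ 4 * g t \<le> (\<kappa> ^ i) ^ 3 * (\<sigma> * \<kappa> * R k) ^ 3" .
    qed
    then have "3 * Q k * (d / 2) ^ 4 * (16 / 3 * R k) \<le> C * (\<sigma> * \<kappa> * R k) ^ 3 * e i ^ 4 * (16 / 3 * R k)"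
      using R_pos[of k] by (intro mult_right_mono) auto
    moreover have "3 * Q k * (d / 2) ^ 4 * (16 / 3 * R k) = d ^ 4 * h k ^ 4"
      unfolding h4 H_def by (simp add: power_divide)
    moreover have "C * (\<sigma> * \<kappa> * R k) ^ 3 * e i ^ 4 * (16 / 3 * R k) = C1 ^ 4 * R k ^ 4 * e i ^ 4"
      unfolding C1(2) power_mult_distrib by (simp add: power_numeral_reduce)
    ultimately have "(d * h k) ^ 4 \<le> (C1 * R k * e i) ^ 4" unfolding power_mult_distrib by linarith
    then show ?thesis
      using power_le_imp_le_base[of "d * h k" 3 "C1 * R k * e i"] C1(1) R_pos[of k] e(1)[of i]
      by (simp add: d_def numeral_eq_Suc)
  qed
  define E where "E = (\<lambda>n. \<Sum>l<n. e l)"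
  have E_mono: "E i \<le> E j" if "i \<le> j" for i j
    unfolding E_def using that e(1) by (intro sum_mono2) auto
  have E_Suc: "E (Suc i) = E i + e i" for i by (simp add: E_def)
  define S where "S = suminf e"
  have ES: "E i \<le> S" for i unfolding E_def S_def using e by (intro sum_le_suminf) auto
  have E0: "E i \<ge> 0" for i unfolding E_def using e by (intro sum_nonneg) auto
  have eS: "e i \<le> S" for i using ES[of "Suc i"] E0[of i] E_Suc[of i] by simp
  have S0: "S \<ge> 0" using E0[of 0] ES[of 0] by simp
  \<comment> \<open>Induction on the number of levels allowed: when \<open>w\<close> crosses the
    lower threshold of the top level, continuity supplies a point at which to cut the
    interval.\<close>
  have levels: "(\<rho>' - \<rho>) * h k \<le> C1 * R k * (E (Suc (i + n)) - E i)"
    if "b \<le> \<rho>" "\<rho> \<le> \<rho>'" "R k \<le> \<rho>" "\<rho>' \<le> R (Suc k)"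
      and "\<kappa> ^ i \<le> w \<rho>" "w \<rho>' \<le> \<kappa> ^ Suc (i + n)" for \<rho> \<rho>' k i n
    using that
  proof (induction n arbitrary: \<rho>')
    case 0
    then show ?case using level[of \<rho> \<rho>' k i] by (simp add: E_Suc)
  next
    case (Suc n)
    let ?j = "Suc (i + n)"
    have CR: "C1 * R k \<ge> 0" using C1 R_pos[of k] by simp
    consider "w \<rho>' \<le> \<kappa> ^ ?j" | "\<kappa> ^ ?j \<le> w \<rho>" | "w \<rho> \<le> \<kappa> ^ ?j" "\<kappa> ^ ?j \<le> w \<rho>'" by linarith
    then show ?case
    proof cases
      case 1
      then have "(\<rho>' - \<rho>) * h k \<le> C1 * R k * (E ?j - E i)" using Suc by simp
      also have "\<dots> \<le> C1 * R k * (E (Suc (i + Suc n)) - E i)"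
        using E_mono[of ?j "Suc (i + Suc n)"] CR by (intro mult_left_mono) auto
      finally show ?thesis .
    next
      case 2
      then have "(\<rho>' - \<rho>) * h k \<le> C1 * R k * e ?j" using Suc.prems by (intro level) auto
      also have "\<dots> \<le> C1 * R k * (E (Suc (i + Suc n)) - E i)"
        using E_mono[of i ?j] CR E_Suc[of ?j] by (intro mult_left_mono) auto
      finally show ?thesis .
    next
      case 3
      have "continuous_on {\<rho>..\<rho>'} w"
        unfolding w_def using Suc.prems b a
        by (intro continuous_intros continuous_on_subset[OF N_cont]) auto
      then obtain c where c: "\<rho> \<le> c" "c \<le> \<rho>'" "w c = \<kappa> ^ ?j"
        using IVT'[of w \<rho> "\<kappa> ^ ?j" \<rho>'] 3 Suc.prems by auto
      have "(c - \<rho>) * h k \<le> C1 * R k * (E ?j - E i)" using Suc.IH[of c] Suc.prems c by simp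
      moreover have "(\<rho>' - c) * h k \<le> C1 * R k * e ?j"
        using Suc.prems c by (intro level) auto
      moreover have "E (Suc (i + Suc n)) = E ?j + e ?j" using E_Suc[of ?j] by simp
      ultimately show ?thesis by (simp add: algebra_simps)
    qed
  qed
  have "\<forall>k. \<exists>l. K \<le> k \<longrightarrow> \<kappa> ^ l \<le> w (R k) \<and> w (R k) < \<kappa> ^ Suc l"
    using power_level_exists[OF \<kappa>(1)] w1 RK by blast
  then obtain lev where lev: "\<And>k. K \<le> k \<Longrightarrow> \<kappa> ^ lev k \<le> w (R k)"
      "\<And>k. K \<le> k \<Longrightarrow> w (R k) < \<kappa> ^ Suc (lev k)"
    by metis
  have lev_mono: "lev k \<le> lev (Suc k)" if k: "K \<le> k" for k
  proof -
    have "\<kappa> ^ lev k < \<kappa> ^ Suc (lev (Suc k))"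
      using lev(1)[OF k] lev(2)[of "Suc k"] w_mono[of "R k" "R (Suc k)"] RK[OF k] R_less_Suc[of k] k by simp
    then show ?thesis using power_less_imp_less_exp[OF \<kappa>(1)] less_Suc_eq_le by blast
  qed
  \<comment> \<open>If the level changes on block \<open>k\<close>, the increment of \<open>V\<close> covers every level met, both end levels included.\<close>
  define V where "V = (\<lambda>k. E (lev k) + E (Suc (lev k)))"
  have V_mono: "V k \<le> V (Suc k)" if "K \<le> k" for k
    unfolding V_def using lev_mono[OF that] by (intro add_mono E_mono) auto
  have V0: "V k \<ge> 0" and VS: "V k \<le> 2 * S" for k
    using E0[of "lev k"] E0[of "Suc (lev k)"] ES[of "lev k"] ES[of "Suc (lev k)"] by (auto simp: V_def)
  define C2 where "C2 = C1 / (\<sigma> - 1)"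
  have C2: "C2 \<ge> 0" using C1 sigma by (simp add: C2_def)
  have fast: "H k \<le> C2 ^ 4 * (2 * S) ^ 3 * (V (Suc k) - V k)"
    if k: "K \<le> k" and lt: "lev k < lev (Suc k)" for k
  proof -
    obtain n where n: "lev (Suc k) = lev k + n" using lt less_imp_add_positive by metis
    have "(R (Suc k) - R k) * h k \<le> C1 * R k * (E (Suc (lev k + n)) - E (lev k))"
      using RK[OF k] R_less_Suc[of k] lev(1)[OF k] lev(2)[of "Suc k"] k n by (intro levels) auto
    then have "R k * ((\<sigma> - 1) * h k) \<le> R k * (C1 * (E (Suc (lev (Suc k))) - E (lev k)))"
      by (simp add: n R_Suc algebra_simps)
    then have "(\<sigma> - 1) * h k \<le> C1 * (E (Suc (lev (Suc k))) - E (lev k))"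
      using R_pos[of k] by simp
    also have "\<dots> \<le> C1 * (V (Suc k) - V k)"
      unfolding V_def using C1 E_mono[of "Suc (lev k)" "lev (Suc k)"] lt by (intro mult_left_mono) auto
    finally have hk: "h k \<le> C2 * (V (Suc k) - V k)"
      using sigma by (simp add: C2_def field_simps)
    have "H k \<le> (C2 * (V (Suc k) - V k)) ^ 4"
      unfolding h4[symmetric] using hk h0 by (rule power_mono)
    \<comment> \<open>One factor is kept for telescoping; the other three are at most 2 S since 0
      \<le> V \<le> 2 S.\<close>
    also have "\<dots> = C2 ^ 4 * ((V (Suc k) - V k) ^ 3 * (V (Suc k) - V k))"
      by (simp add: power_mult_distrib power_numeral_reduce)
    also have "\<dots> \<le> C2 ^ 4 * ((2 * S) ^ 3 * (V (Suc k) - V k))"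
      using V_mono[OF k] V0[of k] VS[of "Suc k"] C2
      by (intro mult_left_mono mult_right_mono power_mono) auto
    finally show ?thesis by (simp add: algebra_simps)
  qed
  define D where "D = 2 * \<sigma> * \<kappa> / (\<sigma> - 1)"
  have D: "D > 0" using sigma \<kappa> by (simp add: D_def)
  \<comment> \<open>Truncating at \<open>D\<^sup>3\<close> loses nothing on blocks staying in level \<open>l\<close> (there \<open>z \<le> D \<kappa>\<^sup>l\<close> up to the
    midpoint), and makes the total increment over all blocks bounded uniformly in \<open>l\<close>.\<close>
  define T where "T = (\<lambda>l k. min (z (R k) ^ 3 / (\<kappa> ^ l) ^ 3) (D ^ 3))"
  have kl: "(\<kappa> ^ l) ^ 3 > 0" for l :: nat using \<kappa> by simp
  have z3_mono: "z r ^ 3 \<le> z s ^ 3" if "b \<le> r" "r \<le> s" for r s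
    using z_mono[of r s] z_pos[of r] that b by (intro power_mono) auto
  have T_mono: "T l k \<le> T l (Suc k)" if k: "K \<le> k" for l k
    unfolding T_def using z3_mono[OF RK[OF k], of "R (Suc k)"] R_less_Suc[of k] kl[of l]
    by (intro min.mono divide_right_mono) auto
  have T0: "T l k \<ge> 0" if k: "K \<le> k" for l k
    unfolding T_def using z_pos[of "R k"] RK[OF k] b kl[of l] D by simp
  have TD: "T l k \<le> D ^ 3" for l k by (simp add: T_def)
  \<comment> \<open>Weighting by \<open>e l\<close> merges the truncated slopes of all levels into
    one bounded potential.\<close>
  define \<Phi> where "\<Phi> = (\<lambda>k. \<Sum>l. e l * T l k)"
  have sumT: "summable (\<lambda>l. e l * T l k)" if k: "K \<le> k" for k
  proof (rule summable_comparison_test'[of "\<lambda>l. e l * D ^ 3" 0])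
    show "summable (\<lambda>l. e l * D ^ 3)" using e(2) by (rule summable_mult2)
    show "norm (e l * T l k) \<le> e l * D ^ 3" for l
      using e(1)[of l] T0[OF k, of l] TD[of l k] by (simp add: mult_left_mono)
  qed
  have \<Phi>_bound: "\<Phi> k \<le> S * D ^ 3" if k: "K \<le> k" for k
  proof -
    have "\<Phi> k \<le> (\<Sum>l. e l * D ^ 3)"
      unfolding \<Phi>_def using e TD sumT[OF k] by (intro suminf_le mult_left_mono summable_mult2) auto
    then show ?thesis using e(2) by (simp add: S_def suminf_mult2)
  qed
  \<comment> \<open>All terms of the increment are nonnegative, so any single level can be
    isolated.\<close>
  have \<Phi>_step: "e l * (T l (Suc k) - T l k) \<le> \<Phi> (Suc k) - \<Phi> k" if k: "K \<le> k" for l k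
  proof -
    have sm: "summable (\<lambda>l. e l * T l (Suc k) - e l * T l k)"
      using sumT[OF k] sumT[of "Suc k"] k by (intro summable_diff) auto
    have nn: "0 \<le> e l * T l (Suc k) - e l * T l k" for l
      using mult_left_mono[OF T_mono[OF k, of l] e(1)[of l]] by simp
    have "\<Phi> (Suc k) - \<Phi> k = (\<Sum>l. e l * T l (Suc k) - e l * T l k)"
      unfolding \<Phi>_def using sumT[OF k] sumT[of "Suc k"] k by (intro suminf_diff) auto
    also have "\<dots> \<ge> (\<Sum>l\<in>{l}. e l * T l (Suc k) - e l * T l k)"
      using sm nn by (intro sum_le_suminf) auto
    finally show ?thesis by (simp add: algebra_simps)
  qed
  \<comment> \<open>Of the four factors \<open>e l\<close> produced by \<open>key\<close>, three are
    bounded by \<open>S\<close> and one is the weight in \<open>\<Phi>\<close>; the last factor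
    stems from the half-length of a block.\<close>
  define C3 where "C3 = C * S ^ 3 * (2 / (3 * (\<sigma> - 1)))"
  have C3: "C3 \<ge> 0" using C S0 sigma by (simp add: C3_def)
  have slow: "H k \<le> C3 * (\<Phi> (Suc k) - \<Phi> k)"
    if k: "K \<le> k" and eq: "lev (Suc k) = lev k" for k
  proof -
    define l where "l = lev k"
    define m where "m = (R k + R (Suc k)) / 2"
    have m: "R k \<le> m" "m \<le> R (Suc k)" "m - R k = (\<sigma> - 1) * R k / 2"
      using R_less_Suc[of k] R_Suc[of k] by (auto simp: m_def field_simps)
    have wS: "w (R (Suc k)) \<le> \<kappa> ^ Suc l" using lev(2)[of "Suc k"] k eq by (simp add: l_def)
    have "z m * ((R (Suc k) - R k) / 2) \<le> \<kappa> ^ l * (\<sigma> * \<kappa> * R k)"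
      unfolding m_def using z_mid_bound[of "R k" "R (Suc k)" k \<kappa> l] wS RK[OF k] b R_less_Suc[of k] \<kappa> by simp
    then have "R k * (z m * (\<sigma> - 1)) \<le> R k * (\<kappa> ^ l * (2 * \<sigma> * \<kappa>))"
      by (simp add: R_Suc algebra_simps)
    then have "z m * (\<sigma> - 1) \<le> \<kappa> ^ l * (2 * \<sigma> * \<kappa>)" using R_pos[of k] by simp
    then have "z m \<le> \<kappa> ^ l * D" using sigma by (simp add: D_def field_simps)
    then have "z m ^ 3 \<le> (\<kappa> ^ l) ^ 3 * D ^ 3"
      unfolding power_mult_distrib[symmetric] using z_pos[of m] m RK[OF k] b by (intro power_mono) auto
    moreover have "z m ^ 3 \<le> z (R (Suc k)) ^ 3" using z3_mono m RK[OF k] by auto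
    ultimately have Tm: "z m ^ 3 / (\<kappa> ^ l) ^ 3 \<le> T l (Suc k)"
      unfolding T_def using kl[of l] \<kappa> by (simp add: divide_right_mono divide_le_eq mult.commute)
    have Tk: "T l k \<le> z (R k) ^ 3 / (\<kappa> ^ l) ^ 3" by (simp add: T_def)
    have diff: "z m ^ 3 - z (R k) ^ 3 \<le> (\<kappa> ^ l) ^ 3 * (T l (Suc k) - T l k)"
    proof -
      have "(z m ^ 3 - z (R k) ^ 3) / (\<kappa> ^ l) ^ 3 \<le> T l (Suc k) - T l k"
        using Tm Tk by (simp add: diff_divide_distrib)
      then show ?thesis using kl[of l] by (simp add: pos_divide_le_eq mult.commute)
    qed
    have "3 * (\<sigma> - 1) / 2 * H k \<le> C * (T l (Suc k) - T l k) * e l ^ 4"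
    proof (rule key)
      show "0 \<le> 3 * (\<sigma> - 1) / 2 * H k" using H_nonneg[of k] sigma by simp
      show "0 \<le> T l (Suc k) - T l k" using T_mono[OF k, of l] by simp
      fix t assume t: "\<kappa> ^ l \<le> t" "t < \<kappa> ^ Suc l"
      have "z m ^ 3 \<ge> z (R k) ^ 3 + 3 * (Q k * g t) * (m - R k)"
        using m wS RK[OF k] lev(1)[OF k] w_mono[of m "R (Suc k)"]
        by (intro level_interval_bound[OF \<kappa> b w_mono t]) (auto simp: l_def)
      then have "3 * (Q k * g t) * ((\<sigma> - 1) * R k / 2) \<le> z m ^ 3 - z (R k) ^ 3" using m(3) by simp
      also note diff
      finally show "3 * (\<sigma> - 1) / 2 * H k * g t \<le> (\<kappa> ^ l) ^ 3 * (T l (Suc k) - T l k)"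
        by (simp add: H_def algebra_simps)
    qed
    also have "\<dots> = C * (T l (Suc k) - T l k) * (e l ^ 3 * e l)" by (simp add: power_numeral_reduce)
    also have "\<dots> \<le> C * (T l (Suc k) - T l k) * (S ^ 3 * e l)"
      using C T_mono[OF k, of l] eS[of l] e(1)[of l]
      by (intro mult_left_mono mult_right_mono power_mono) auto
    also have "\<dots> = C * S ^ 3 * (e l * (T l (Suc k) - T l k))" by (simp add: mult_ac)
    also have "\<dots> \<le> C * S ^ 3 * (\<Phi> (Suc k) - \<Phi> k)"
      using C S0 \<Phi>_step[OF k] by (intro mult_left_mono) auto
    finally have "3 * (\<sigma> - 1) / 2 * H k \<le> C * S ^ 3 * (\<Phi> (Suc k) - \<Phi> k)" .
    then have "2 / (3 * (\<sigma> - 1)) * (3 * (\<sigma> - 1) / 2 * H k)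
        \<le> 2 / (3 * (\<sigma> - 1)) * (C * S ^ 3 * (\<Phi> (Suc k) - \<Phi> k))"
      using sigma by (intro mult_left_mono) auto
    moreover have "2 / (3 * (\<sigma> - 1)) * (3 * (\<sigma> - 1) / 2 * H k) = H k" using sigma by simp
    ultimately show ?thesis by (simp add: C3_def mult_ac)
  qed
  define C4 where "C4 = C2 ^ 4 * (2 * S) ^ 3"
  have C4: "C4 \<ge> 0" using C2 S0 by (simp add: C4_def)
  show ?thesis
  proof (rule summable_by_bounded_potential[where K = K
        and \<Phi> = "\<lambda>k. C3 * \<Phi> k + C4 * V k" and B = "C3 * (S * D ^ 3) + C4 * (2 * S)"])
    fix k assume k: "K \<le> k"
    show "C3 * \<Phi> k + C4 * V k \<le> C3 * (S * D ^ 3) + C4 * (2 * S)"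
      using C3 C4 \<Phi>_bound[OF k] VS by (intro add_mono mult_left_mono) auto
    \<comment> \<open>Each block uses one of the two potentials, so the other must not decrease. For
      \<open>\<Phi>\<close> isolating any one level shows this; 0 is chosen.\<close>
    have nn1: "0 \<le> C4 * (V (Suc k) - V k)" using C4 V_mono[OF k] by simp
    have "0 \<le> e 0 * (T 0 (Suc k) - T 0 k)" using e(1)[of 0] T_mono[OF k, of 0] by simp
    then have nn2: "0 \<le> C3 * (\<Phi> (Suc k) - \<Phi> k)" using C3 \<Phi>_step[OF k, of 0] by simp
    show "H k \<le> C3 * \<Phi> (Suc k) + C4 * V (Suc k) - (C3 * \<Phi> k + C4 * V k)"
    proof (cases "lev (Suc k) = lev k")
      case True
      then show ?thesis using slow[OF k] nn1 by (simp add: algebra_simps)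
    next
      case False
      then show ?thesis using fast[OF k] lev_mono[OF k] nn2 by (simp add: C4_def algebra_simps)
    qed
  qed (rule H_nonneg)
qed

end

section \<open>The two integral conditions\<close>

text \<open>\<open>e j\<close> is the integral over level \<open>j\<close>. The assumed bound on
  \<open>y * g t\<close> gives g t * t \<le> G, where \<open>G\<close> is \<kappa>^(4 j) times
  \<kappa> m / y, so \<open>e j\<close> is at least G^(-1/4) times the length (\<kappa> - 1)
  \<kappa>^j. In the fourth power all \<kappa>^j cancel, leaving C = \<kappa> / (\<kappa> -
  1)^4.\<close>

lemma level_weights:
  fixes g :: "real \<Rightarrow> real" and \<kappa> :: real
  assumes g_meas: "set_borel_measurable lebesgue {0<..} g"
    and g_pos: "\<And>t. t > 0 \<Longrightarrow> g t > 0" and \<kappa>: "\<kappa> > 1"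
    and int_g: "(\<integral>\<^sup>+ t\<in>{1..}. ennreal ((g t * t) powr (-1/4)) \<partial>lebesgue) < \<infinity>"
  obtains e :: "nat \<Rightarrow> real" and C :: real where "\<And>j. e j \<ge> 0" "summable e" "C \<ge> 0"
    "\<And>j y m. y \<ge> 0 \<Longrightarrow> m \<ge> 0 \<Longrightarrow>
      (\<And>t. \<kappa> ^ j \<le> t \<Longrightarrow> t < \<kappa> ^ Suc j \<Longrightarrow> y * g t \<le> (\<kappa> ^ j) ^ 3 * m) \<Longrightarrow> y \<le> C * m * e j ^ 4"
proof -
  define h where "h = (\<lambda>t. ennreal ((g t * t) powr (-1/4)))"
  define D where "D = (\<lambda>j. {\<kappa> ^ j..<\<kappa> ^ Suc j})"
  define I where "I = (\<lambda>j. \<integral>\<^sup>+ t. h t * indicator (D j) t \<partial>lebesgue)"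
  have k1: "\<kappa> ^ j \<ge> 1" for j using \<kappa> by simp
  have D_pos: "t > 0" if "t \<in> D j" for t j using that k1[of j] by (auto simp: D_def)
  \<comment> \<open>Measurability of \<open>g\<close> is given for its cut-off to the positive axis;
    every level lies there, so the cut-off changes nothing.\<close>
  have meas: "(\<lambda>t. h t * indicator (D j) t) \<in> borel_measurable lebesgue" for j
  proof -
    have [measurable]: "(\<lambda>t. indicator {0<..} t *\<^sub>R g t) \<in> borel_measurable lebesgue"
      using g_meas by (simp add: set_borel_measurable_def)
    have [measurable]: "(\<lambda>t::real. t) \<in> borel_measurable lebesgue"
      by (rule measurable_completion) simp
    have [measurable]: "D j \<in> sets lebesgue" by (simp add: D_def)
    have "(\<lambda>t. ennreal (((indicator {0<..} t *\<^sub>R g t) * t) powr (-1/4)) * indicator (D j) t)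
        \<in> borel_measurable lebesgue"
      by measurable
    moreover have "(\<lambda>t. ennreal (((indicator {0<..} t *\<^sub>R g t) * t) powr (-1/4)) * indicator (D j) t)
        = (\<lambda>t. h t * indicator (D j) t)"
      using D_pos by (auto simp: fun_eq_iff h_def indicator_def)
    ultimately show ?thesis by simp
  qed
  have disj: "disjoint_family D"
  proof -
    have "D i \<inter> D j = {}" if "i < j" for i j
    proof -
      have "\<kappa> ^ Suc i \<le> \<kappa> ^ j" using that \<kappa> by (intro power_increasing) auto
      then show ?thesis by (auto simp: D_def)
    qed
    then show ?thesis unfolding disjoint_family_on_def by (metis Int_commute linorder_neqE_nat)
  qed
  have "(\<Sum>j. I j) = (\<integral>\<^sup>+ t. (\<Sum>j. h t * indicator (D j) t) \<partial>lebesgue)"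
    unfolding I_def using meas by (rule nn_integral_suminf[symmetric])
  also have "\<dots> \<le> (\<integral>\<^sup>+ t. h t * indicator {1..} t \<partial>lebesgue)"
  proof (rule nn_integral_mono)
    fix t
    have "(\<Sum>j. h t * indicator (D j) t) = h t * indicator (\<Union>j. D j) t"
      using disj by (simp add: suminf_indicator)
    also have "\<dots> \<le> h t * indicator {1..} t"
      using k1 by (intro mult_left_mono) (auto simp: D_def indicator_def intro: order_trans)
    finally show "(\<Sum>j. h t * indicator (D j) t) \<le> h t * indicator {1..} t" .
  qed
  also have "\<dots> < \<infinity>" using int_g by (simp add: h_def)
  finally have fin: "(\<Sum>j. I j) < \<infinity>" .
  have finI: "I j < \<infinity>" for j
    using ennreal_suminf_lessD[of I] fin by simp
  define e where "e = (\<lambda>j. enn2real (I j))"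
  have eI: "ennreal (e j) = I j" for j unfolding e_def using finI[of j] by simp
  have e0: "e j \<ge> 0" for j by (simp add: e_def)
  have es: "summable e"
    using fin by (intro summable_suminf_not_top e0) (simp add: eI)
  show ?thesis
  proof (rule that[OF e0 es, of "\<kappa> / (\<kappa> - 1) ^ 4"])
    show "0 \<le> \<kappa> / (\<kappa> - 1) ^ 4" using \<kappa> by simp
    fix j and y m :: real
    assume y: "y \<ge> 0" and m: "m \<ge> 0"
      and le: "\<And>t. \<kappa> ^ j \<le> t \<Longrightarrow> t < \<kappa> ^ Suc j \<Longrightarrow> y * g t \<le> (\<kappa> ^ j) ^ 3 * m"
    show "y \<le> \<kappa> / (\<kappa> - 1) ^ 4 * m * e j ^ 4"
    proof (cases "y = 0")
      case True
      then show ?thesis using \<kappa> m by simp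
    next
      case False
      with y have y0: "y > 0" by simp
      have kj: "\<kappa> ^ j > 0" using \<kappa> by simp
      \<comment> \<open>The left end of the level excludes \<open>m = 0\<close>, which makes
        \<open>G\<close> positive.\<close>
      have "0 < y * g (\<kappa> ^ j)" using y0 g_pos[OF kj] by simp
      also have "\<dots> \<le> (\<kappa> ^ j) ^ 3 * m" using \<kappa> by (intro le) auto
      finally have m0: "m > 0" using zero_less_mult_pos zero_less_power[OF kj] by blast
      define G where "G = (\<kappa> ^ j) ^ 4 * (\<kappa> * m / y)"
      have G0: "G > 0" using kj \<kappa> m0 y0 by (simp add: G_def)
      have gG: "G powr (-1/4) \<le> (g t * t) powr (-1/4)" if t: "t \<in> D j" for t
      proof (rule powr_mono2')
        have t0: "t > 0" using D_pos[OF t] .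
        show "0 < g t * t" using g_pos[OF t0] t0 by simp
        have "g t \<le> (\<kappa> ^ j) ^ 3 * m / y" using le[of t] t y0 by (simp add: D_def field_simps)
        then have "g t * t \<le> (\<kappa> ^ j) ^ 3 * m / y * (\<kappa> * \<kappa> ^ j)"
          using t t0 y0 m0 kj g_pos[OF t0] by (intro mult_mono) (auto simp: D_def)
        also have "\<dots> = G" by (simp add: G_def power_numeral_reduce)
        finally show "g t * t \<le> G" .
      qed simp
      have "ennreal (G powr (-1/4) * ((\<kappa> - 1) * \<kappa> ^ j)) = ennreal (G powr (-1/4)) * emeasure lebesgue (D j)"
      proof -
        have "emeasure lebesgue (D j) = ennreal ((\<kappa> - 1) * \<kappa> ^ j)"
          using \<kappa> by (simp add: D_def algebra_simps)
        then show ?thesis by (simp add: ennreal_mult')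
      qed
      also have "\<dots> = (\<integral>\<^sup>+ t. ennreal (G powr (-1/4)) * indicator (D j) t \<partial>lebesgue)"
        by (rule nn_integral_cmult_indicator[symmetric]) (simp add: D_def)
      also have "\<dots> \<le> I j"
        unfolding I_def h_def using gG by (intro nn_integral_mono) (auto simp: indicator_def)
      finally have "G powr (-1/4) * ((\<kappa> - 1) * \<kappa> ^ j) \<le> e j"
        unfolding eI[symmetric] using e0 by simp
      then have "(G powr (-1/4) * ((\<kappa> - 1) * \<kappa> ^ j)) ^ 4 \<le> e j ^ 4"
        using \<kappa> by (intro power_mono) auto
      moreover have "(G powr (-1/4)) ^ 4 = 1 / G"
        using G0 by (simp add: powr_power powr_minus_divide power_divide)
      ultimately have "1 / G * ((\<kappa> - 1) ^ 4 * (\<kappa> ^ j) ^ 4) \<le> e j ^ 4"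
        by (simp only: power_mult_distrib)
      moreover have "1 / G * ((\<kappa> - 1) ^ 4 * (\<kappa> ^ j) ^ 4) = y * ((\<kappa> - 1) ^ 4 / (\<kappa> * m))"
        unfolding G_def using kj \<kappa> m0 y0 by (simp add: field_simps)
      ultimately have "y * ((\<kappa> - 1) ^ 4 / (\<kappa> * m)) \<le> e j ^ 4" by simp
      moreover have "(\<kappa> - 1) ^ 4 / (\<kappa> * m) > 0" using \<kappa> m0 by simp
      ultimately have "y \<le> e j ^ 4 / ((\<kappa> - 1) ^ 4 / (\<kappa> * m))" by (simp only: pos_le_divide_eq)
      then show ?thesis by (simp add: mult_ac)
    qed
  qed
qed

section \<open>The condition on q\<close>

text \<open>The step function with value \<open>Q k\<close> on block \<open>k\<close> dominates
  \<open>q\<close>, and its integral is \<sigma> - 1 times the given series.\<close>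

lemma nn_integral_finite_if_blocks_summable:
  fixes q :: "real \<Rightarrow> real"
  assumes "r\<^sub>0 > 0" "\<sigma> > 1" and Q0: "\<And>k. Q k \<ge> 0"
    and qQ: "\<And>k r. r\<^sub>0 * \<sigma> ^ k < r \<Longrightarrow> r \<le> r\<^sub>0 * \<sigma> ^ Suc k \<Longrightarrow> q r \<le> Q k"
    and sm: "summable (\<lambda>k. Q k * (r\<^sub>0 * \<sigma> ^ k))"
  shows "(\<integral>\<^sup>+ r\<in>{r\<^sub>0<..}. ennreal (q r) \<partial>lebesgue) < \<infinity>"
proof -
  define B where "B = (\<lambda>k. {r\<^sub>0 * \<sigma> ^ k<..r\<^sub>0 * \<sigma> ^ Suc k})"
  have "(\<integral>\<^sup>+ r\<in>{r\<^sub>0<..}. ennreal (q r) \<partial>lebesgue)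
      \<le> (\<integral>\<^sup>+ r. (\<Sum>k. ennreal (Q k) * indicator (B k) r) \<partial>lebesgue)"
  proof (rule nn_integral_mono)
    fix r :: real
    show "ennreal (q r) * indicator {r\<^sub>0<..} r \<le> (\<Sum>k. ennreal (Q k) * indicator (B k) r)"
    proof (cases "r > r\<^sub>0")
      case True
      \<comment> \<open>The least endpoint not below \<open>r\<close>. Its index is not 0 because
        \<open>r > r\<^sub>0\<close>, so \<open>r\<close> lies in the block preceding it.\<close>
      define n where "n = (LEAST n. r \<le> r\<^sub>0 * \<sigma> ^ n)"
      obtain n' where "r / r\<^sub>0 < \<sigma> ^ n'" using real_arch_pow assms(2) by blast
      then have "r \<le> r\<^sub>0 * \<sigma> ^ n'" using assms(1) by (simp add: field_simps)
      then have n: "r \<le> r\<^sub>0 * \<sigma> ^ n" unfolding n_def by (rule LeastI)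
      then have "n \<noteq> 0" using True by (intro notI) simp
      then obtain k where k: "n = Suc k" using not0_implies_Suc by auto
      have "\<not> r \<le> r\<^sub>0 * \<sigma> ^ k" using not_less_Least[of k "\<lambda>n. r \<le> r\<^sub>0 * \<sigma> ^ n"] k n_def by simp
      then have rk: "r \<in> B k" using n k by (simp add: B_def)
      define F where "F = (\<lambda>k. ennreal (Q k) * indicator (B k) r)"
      have "ennreal (q r) \<le> F k"
        using qQ rk by (simp add: F_def B_def ennreal_leI)
      also have "F k \<le> suminf F" using sum_le_suminf[of F "{k}"] by simp
      finally show ?thesis using True by (simp add: F_def)
    qed simp
  qed
  also have "\<dots> = (\<Sum>k. \<integral>\<^sup>+ r. ennreal (Q k) * indicator (B k) r \<partial>lebesgue)"
    by (rule nn_integral_suminf) (intro borel_measurable_times_ennreal borel_measurable_indicator, auto simp: B_def)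
  also have "\<dots> = (\<Sum>k. ennreal ((\<sigma> - 1) * (Q k * (r\<^sub>0 * \<sigma> ^ k))))"
  proof (rule suminf_cong)
    fix k
    have "(\<integral>\<^sup>+ r. ennreal (Q k) * indicator (B k) r \<partial>lebesgue) = ennreal (Q k) * emeasure lebesgue (B k)"
      by (rule nn_integral_cmult_indicator) (simp add: B_def)
    also have "emeasure lebesgue (B k) = ennreal ((\<sigma> - 1) * (r\<^sub>0 * \<sigma> ^ k))"
      using assms(1,2) by (simp add: B_def algebra_simps)
    also have "ennreal (Q k) * \<dots> = ennreal ((\<sigma> - 1) * (Q k * (r\<^sub>0 * \<sigma> ^ k)))"
      using Q0[of k] by (simp add: ennreal_mult'[symmetric] mult_ac)
    finally show "(\<integral>\<^sup>+ r. ennreal (Q k) * indicator (B k) r \<partial>lebesgue) = \<dots>" .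
  qed
  also have "\<dots> < \<infinity>"
    using summable_mult[OF sm, of "\<sigma> - 1"] assms(1,2) Q0
    by (subst suminf_ennreal2) auto
  finally show ?thesis .
qed

section \<open>Vanishing of nonnegative solutions\<close>

theorem theorem1:
  fixes \<Omega> :: "(real^'n) set"
    and f :: "real^'n \<Rightarrow> real \<Rightarrow> real"
    and q g :: "real \<Rightarrow> real"
    and r\<^sub>0 \<sigma> \<theta> :: real
    and u :: "real^'n \<Rightarrow> real"
  assumes dim: "CARD('n) \<ge> 2"
    and dom: "open \<Omega>" "connected \<Omega>" "\<Omega> \<noteq> {}"
    and unb: "\<not> bounded \<Omega>"
    and r0: "r\<^sub>0 > 0" "\<forall>r>r\<^sub>0. sphere 0 r \<inter> \<Omega> \<noteq> {}"
    and fpos: "\<forall>x\<in>\<Omega>. \<forall>t>0. f x t > 0"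
    and params: "\<sigma> > 1" "\<theta> > 1"
    and q_meas: "set_borel_measurable lebesgue {r\<^sub>0<..} q"
    and q_nonneg: "\<forall>r>r\<^sub>0. q r \<ge> 0"
    and g_meas: "set_borel_measurable lebesgue {0<..} g"
    and g_nonneg: "\<forall>t>0. g t \<ge> 0"
    and g_inf: "\<forall>K. compact K \<and> K \<noteq> {} \<and> K \<subseteq> {0<..} \<longrightarrow> (INF t\<in>K. g t) > 0"
    and bound: "\<forall>t>0. \<forall>r>r\<^sub>0.
        (INF p\<in>{(x, \<zeta>). x \<in> \<Omega> \<and> r / \<sigma> < norm x \<and> norm x < r * \<sigma>
                       \<and> t / \<theta> < \<zeta> \<and> \<zeta> < t * \<theta>}. f (fst p) (norm (fst p) * snd p))
          \<ge> q r * g t"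
    and int_g: "(\<integral>\<^sup>+ t\<in>{1..}. ennreal ((g t * t) powr (-1/4)) \<partial>lebesgue) < \<infinity>"
    and int_q: "(\<integral>\<^sup>+ r\<in>{r\<^sub>0<..}. ennreal (q r) \<partial>lebesgue) = \<infinity>"
    and sol: "nonneg_solution \<Omega> f u"
  shows "\<forall>x\<in>\<Omega>. u x = 0"
proof (rule ccontr)
  assume "\<not> ?thesis"
  then obtain x\<^sub>1 where x1: "x\<^sub>1 \<in> \<Omega>" "u x\<^sub>1 \<noteq> 0" by auto
  then have "u x\<^sub>1 > 0"
    using sol closure_subset[of \<Omega>] by (force simp: nonneg_solution_def)
  interpret positive_solution \<Omega> f u x\<^sub>1
    using dom(1) fpos sol x1(1) \<open>u x\<^sub>1 > 0\<close> by unfold_locales auto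
  have g_lower: "\<exists>\<gamma>>0. \<forall>t\<in>{\<alpha>..\<beta>}. \<gamma> \<le> g t" if "0 < \<alpha>" "\<alpha> \<le> \<beta>" for \<alpha> \<beta>
  proof (intro exI conjI ballI)
    show "(INF t\<in>{\<alpha>..\<beta>}. g t) > 0" using g_inf that by auto
    fix t assume "t \<in> {\<alpha>..\<beta>}"
    then show "(INF t\<in>{\<alpha>..\<beta>}. g t) \<le> g t"
      using g_nonneg that by (intro cINF_lower bdd_belowI2[of _ 0]) auto
  qed
  have g_pos: "g t > 0" if "t > 0" for t using g_lower[of t t] that by auto
  have fb: "q s * g t \<le> f x (norm x * \<zeta>)"
    if "t > 0" "s > r\<^sub>0" "x \<in> \<Omega>" "s / \<sigma> < norm x" "norm x < s * \<sigma>" "t / \<theta> < \<zeta>" "\<zeta> < t * \<theta>" for s t x \<zeta>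
  proof -
    let ?A = "{(x, \<zeta>). x \<in> \<Omega> \<and> s / \<sigma> < norm x \<and> norm x < s * \<sigma> \<and> t / \<theta> < \<zeta> \<and> \<zeta> < t * \<theta>}"
    have "q s * g t \<le> (INF p\<in>?A. f (fst p) (norm (fst p) * snd p))"
      using bound that by blast
    also have "\<dots> \<le> f (fst (x, \<zeta>)) (norm (fst (x, \<zeta>)) * snd (x, \<zeta>))"
    proof (rule cINF_lower)
      \<comment> \<open>A real infimum bounds the values only for sets bounded below; positivity of
        \<open>f\<close> supplies the bound 0.\<close>
      show "bdd_below ((\<lambda>p. f (fst p) (norm (fst p) * snd p)) ` ?A)"
      proof (rule bdd_belowI2[of _ 0])
        fix p assume "p \<in> ?A"
        then obtain x' \<zeta>' where p: "p = (x', \<zeta>')" "x' \<in> \<Omega>" "s / \<sigma> < norm x'" "t / \<theta> < \<zeta>'" by auto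
        have "0 < s / \<sigma>" "0 < t / \<theta>" using that r0 params by simp_all
        then have "norm x' > 0" "\<zeta>' > 0" using p by linarith+
        then show "0 \<le> f (fst p) (norm (fst p) * snd p)"
          using fpos p by (simp add: less_imp_le)
      qed
    qed (use that in auto)
    finally show ?thesis by simp
  qed
  define Q where "Q = (\<lambda>k. Sup (q ` {r\<^sub>0 * \<sigma> ^ k<..r\<^sub>0 * \<sigma> ^ Suc k}))"
  have Rpos: "r\<^sub>0 \<le> r\<^sub>0 * \<sigma> ^ k" "r\<^sub>0 * \<sigma> ^ k < r\<^sub>0 * \<sigma> ^ Suc k" for k using r0 params by simp_all
  have qQ: "q s \<le> Q k" if s: "r\<^sub>0 * \<sigma> ^ k < s" "s \<le> r\<^sub>0 * \<sigma> ^ Suc k" for s k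
    unfolding Q_def
  proof (rule cSUP_upper)
    \<comment> \<open>A single point on the outer sphere lies in the shell of every \<open>s\<close>
      in the block, so \<open>f\<close> there bounds \<open>q\<close> on the whole block. The block
      is open at its inner end, which makes \<open>norm x < s * \<sigma>\<close> strict.\<close>
    obtain x where x: "x \<in> \<Omega>" "norm x = r\<^sub>0 * \<sigma> ^ Suc k"
      using r0(2) Rpos[of k] by (metis (no_types, lifting) disjoint_iff mem_sphere_0 order_le_less_trans)
    show "bdd_above (q ` {r\<^sub>0 * \<sigma> ^ k<..r\<^sub>0 * \<sigma> ^ Suc k})"
    proof (rule bdd_aboveI2)
      fix s assume s: "s \<in> {r\<^sub>0 * \<sigma> ^ k<..r\<^sub>0 * \<sigma> ^ Suc k}"
      have s0: "s > r\<^sub>0" "s > 0" using s Rpos(1)[of k] r0(1) unfolding greaterThanAtMost_iff by linarith+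
      have "s < s * \<sigma>" using s0 params by simp
      then have "s / \<sigma> < norm x" using s x params by (simp add: divide_less_eq) (smt (verit) mult_right_mono)
      moreover have "norm x < s * \<sigma>" using s x params by simp
      ultimately have "q s * g 1 \<le> f x (norm x * 1)" using params s0 x by (intro fb) auto
      then show "q s \<le> f x (norm x) / g 1" using g_pos[of 1] by (simp add: field_simps)
    qed
  qed (use s in auto)
  have Q0: "Q k \<ge> 0" for k
  proof -
    have "r\<^sub>0 < r\<^sub>0 * \<sigma> ^ Suc k" using Rpos[of k] by linarith
    then have "0 \<le> q (r\<^sub>0 * \<sigma> ^ Suc k)" using q_nonneg by blast
    also have "\<dots> \<le> Q k" using qQ[OF Rpos(2)] by simp
    finally show ?thesis .
  qed
  interpret rg: radial_growth N z g Q "norm x\<^sub>1" r\<^sub>0 \<sigma> \<theta>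
  proof
    fix \<rho> \<rho>' k \<gamma>
    assume \<rho>: "norm x\<^sub>1 < \<rho>" "\<rho> \<le> \<rho>'" "r\<^sub>0 * \<sigma> ^ k \<le> \<rho>" "\<rho>' \<le> r\<^sub>0 * \<sigma> ^ Suc k" and \<gamma>: "\<gamma> \<ge> 0"
      and ex: "\<And>r. \<rho> < r \<Longrightarrow> r < \<rho>' \<Longrightarrow> \<exists>t>0. t / \<theta> < N r / r \<and> N r / r < t * \<theta> \<and> \<gamma> \<le> g t"
    show "z \<rho> ^ 3 + 3 * (Q k * \<gamma>) * (\<rho>' - \<rho>) \<le> z \<rho>' ^ 3"
    proof (rule z_cube_growth)
      fix x assume x: "x \<in> \<Omega>" "\<rho> < norm x" "norm x < \<rho>'" "u x = N (norm x)"
      have nx: "norm x > 0" using x \<rho> norm_ge_zero[of x\<^sub>1] by linarith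
      have fx: "f x (u x) > 0" using f_pos N_attained(2)[of "norm x"] x \<rho> by auto
      show "Q k * \<gamma> \<le> f x (u x)"
      proof (cases "\<gamma> = 0")
        case False
        obtain t where t: "t > 0" "t / \<theta> < N (norm x) / norm x" "N (norm x) / norm x < t * \<theta>" "\<gamma> \<le> g t"
          using ex x by blast
        \<comment> \<open>A point strictly inside the block lies in the shell of every
          \<open>s\<close> in the block, so the bound passes to the supremum. With \<zeta> = N |x| /
          |x| the second argument of \<open>f\<close> is exactly \<open>u x\<close>.\<close>
        have "Q k \<le> f x (u x) / \<gamma>"
          unfolding Q_def
        proof (rule cSUP_least)
          fix s assume s: "s \<in> {r\<^sub>0 * \<sigma> ^ k<..r\<^sub>0 * \<sigma> ^ Suc k}"
          have s0: "s > r\<^sub>0" "s > 0" using s Rpos(1)[of k] r0(1) unfolding greaterThanAtMost_iff by linarith+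
          have "s \<le> r\<^sub>0 * \<sigma> ^ k * \<sigma>" using s by (simp add: mult_ac)
          also have "\<dots> < norm x * \<sigma>" using \<rho> x params by simp
          finally have 1: "s / \<sigma> < norm x" using params by (simp add: divide_less_eq)
          have "norm x < r\<^sub>0 * \<sigma> ^ k * \<sigma>" using \<rho> x by (simp add: mult_ac)
          also have "\<dots> < s * \<sigma>" using s params by simp
          finally have "q s * g t \<le> f x (norm x * (N (norm x) / norm x))"
            using 1 t s0 x by (intro fb) auto
          moreover have "q s * \<gamma> \<le> q s * g t" using t q_nonneg s0 by (intro mult_left_mono) auto
          ultimately have "q s * \<gamma> \<le> f x (u x)" using nx x by simp
          then show "q s \<le> f x (u x) / \<gamma>" using False \<gamma> by (simp add: field_simps)
        qed (use Rpos[of k] in auto)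
        then show ?thesis using False \<gamma> by (simp add: field_simps)
      qed (use fx in simp)
    qed (use \<rho> \<gamma> Q0 in auto)
  qed (use r0 params Q0 g_pos N_attained(2) z_pos N_subgradient N_continuous in auto)
  have "summable rg.H"
  proof (cases "\<exists>b>norm x\<^sub>1. \<exists>B. \<forall>r\<ge>b. rg.w r \<le> B")
    case True
    then show ?thesis using rg.summable_if_bounded g_lower by blast
  next
    case False
    \<comment> \<open>Levels need \<kappa> > 1 to have positive length, and \<kappa> < \<theta> so
      that any two points of a level are comparable.\<close>
    define \<kappa> where "\<kappa> = (1 + \<theta>) / 2"
    have \<kappa>: "1 < \<kappa>" "\<kappa> < \<theta>" using params by (auto simp: \<kappa>_def)
    obtain e C where "\<And>j. e j \<ge> 0" "summable e" "C \<ge> 0"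
      "\<And>j y m. y \<ge> 0 \<Longrightarrow> m \<ge> 0 \<Longrightarrow>
        (\<And>t. \<kappa> ^ j \<le> t \<Longrightarrow> t < \<kappa> ^ Suc j \<Longrightarrow> y * g t \<le> (\<kappa> ^ j) ^ 3 * m) \<Longrightarrow> y \<le> C * m * e j ^ 4"
      using level_weights[OF g_meas g_pos \<kappa>(1) int_g] by blast
    then show ?thesis using False \<kappa> by (intro rg.summable_if_unbounded[of \<kappa> e C]) (auto simp: not_le)
  qed
  then have "summable (\<lambda>k. Q k * (r\<^sub>0 * \<sigma> ^ k))"
    by (simp add: rg.H_def[abs_def] rg.R_def[abs_def])
  then have "(\<integral>\<^sup>+ r\<in>{r\<^sub>0<..}. ennreal (q r) \<partial>lebesgue) < \<infinity>"
    using nn_integral_finite_if_blocks_summable[of r\<^sub>0 \<sigma> Q q] r0(1) params(1) Q0 qQ by blast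
  with int_q show False by simp
qed

end
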